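(* Let $m\ge1$, $j\ge0$, $n\ge1$ be integers. (i) Let $\alpha_0,\alpha_1,\dots,\alpha_n$ be positive integers with $\alpha_0+n+\frac{m-j}{2}-1\notin\{0,-1,-2,\dots\}$. Then for $z_1,\dots,z_n<1$, $$H_{\alpha_0,\alpha_1,\dots,\alpha_n}(z_1,\dots,z_n;m;j)=\frac{\partial_{z_1}^{\alpha_1-1}\cdots\partial_{z_n}^{\alpha_n-1}}{(\alpha_1-1)!\cdots(\alpha_n-1)!}\,H_{\alpha_0,1,\dots,1}(z_1,\dots,z_n;m;j).$$ (ii) Let $a$ be a positive integer with $a+n+\frac{m-j}{2}-1\notin\{0,-1,-2,\dots\}$. Then, with $n$ indices equal to $1$ on the left, $$H_{a,1,\dots,1}(z_1,\dots,z_n;m;j)=\big(z^{n-1}H_{a+n-1,1}(z;m;j)\big)[z_1,\dots,z_n]_z ,\qquad z_1,\dots,z_n<1 .$$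
   Context: For a tuple $\alpha=(\alpha_0,\dots,\alpha_n)$ of positive integers put $|\alpha|=\sum_{l=0}^n\alpha_l$, $d(\alpha;m;j)=|\alpha|+\frac{m-j}{2}-2$, and for $z_1,\dots,z_n<1$ $$H_\alpha(z_1,\dots,z_n;m;j)=\Gamma(d(\alpha;m;j)+1)\int_{\triangle^n}\omega_\alpha(u)\Big(1-\sum_{l=1}^n z_lu_l\Big)^{-d(\alpha;m;j)-1}du,$$ $$\omega_\alpha(u)=\frac{1}{\Gamma(\alpha_0)\cdots\Gamma(\alpha_n)}\Big(1-\sum_{l=1}^n u_l\Big)^{\alpha_0-1}\prod_{l=1}^nu_l^{\alpha_l-1},\qquad \triangle^n=\{u\in\mathbb{R}^n:u_l\ge0,\ \sum_l u_l\le1\}.$$ Divided differences: $f[z_1]_z=f(z_1)$ and, for pairwise distinct nodes, $f[z_1,\dots,z_n]_z=\big(f[z_1,\dots,z_{n-1}]_z-f[z_2,\dots,z_n]_z\big)/(z_1-z_n)=\sum_{l=1}^n f(z_l)\prod_{s\ne l}(z_l-z_s)^{-1}$; for coinciding nodes it is defined by continuous extension (for smooth $f$). The subscript $z$ names the variable of $f$ on which the divided difference acts. *)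

theory Defs
  imports "HOL-Analysis.Analysis"
begin

text \<open>
  A tuple of positive integers indexed by 0..n is a function \<open>\<alpha> :: nat \<Rightarrow> nat\<close> of which only the
  values at \<open>0, \<dots>, n\<close> matter; a point \<open>(z\<^sub>1, \<dots>, z\<^sub>n)\<close> is a function \<open>z :: nat \<Rightarrow> real\<close> of which
  only the values at \<open>1, \<dots>, n\<close> matter. Lebesgue measure on n-space is the product measure
  \<open>\<Pi>\<^sub>M l\<in>{1..n}. lborel\<close>, whose points are the functions that are \<open>undefined\<close> off \<open>{1..n}\<close>.
\<close>

definition d :: "nat \<Rightarrow> (nat \<Rightarrow> nat) \<Rightarrow> nat \<Rightarrow> nat \<Rightarrow> real" where
  "d n \<alpha> m j = real (\<Sum>l=0..n. \<alpha> l) + (real m - real j) / 2 - 2"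

definition simplex_std :: "nat \<Rightarrow> (nat \<Rightarrow> real) set" where
  "simplex_std n = {u \<in> {1..n} \<rightarrow>\<^sub>E {0..}. (\<Sum>l=1..n. u l) \<le> 1}"

definition \<omega> :: "nat \<Rightarrow> (nat \<Rightarrow> nat) \<Rightarrow> (nat \<Rightarrow> real) \<Rightarrow> real" where
  "\<omega> n \<alpha> u = 1 / (\<Prod>l=0..n. Gamma (real (\<alpha> l)))
     * (1 - (\<Sum>l=1..n. u l)) ^ (\<alpha> 0 - 1) * (\<Prod>l=1..n. u l ^ (\<alpha> l - 1))"

definition H :: "nat \<Rightarrow> (nat \<Rightarrow> nat) \<Rightarrow> (nat \<Rightarrow> real) \<Rightarrow> nat \<Rightarrow> nat \<Rightarrow> real" where
  "H n \<alpha> z m j = Gamma (d n \<alpha> m j + 1) *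
     (LINT u:simplex_std n|(\<Pi>\<^sub>M l\<in>{1..n}. lborel).
        \<omega> n \<alpha> u * (1 - (\<Sum>l=1..n. z l * u l)) powr (- d n \<alpha> m j - 1))"

definition partial_deriv ::
  "nat \<Rightarrow> nat \<Rightarrow> ((nat \<Rightarrow> real) \<Rightarrow> real) \<Rightarrow> (nat \<Rightarrow> real) \<Rightarrow> real" where
  "partial_deriv l k F z = (deriv ^^ k) (\<lambda>t. F (z(l := t))) (z l)"

text \<open>The operator of order \<open>k l\<close> in the variable \<open>z\<^sub>l\<close>; the one for \<open>l = 1\<close> is applied last.\<close>

definition mixed_partial ::
  "nat \<Rightarrow> (nat \<Rightarrow> nat) \<Rightarrow> ((nat \<Rightarrow> real) \<Rightarrow> real) \<Rightarrow> (nat \<Rightarrow> real) \<Rightarrow> real" where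
  "mixed_partial n k F = foldr (\<lambda>l. partial_deriv l (k l)) [1..<Suc n] F"

text \<open>\<open>divdiff_rec f z i k\<close> is the divided difference at the \<open>k + 1\<close> nodes \<open>z i, \<dots>, z (i + k)\<close>,
  meaningful when these are pairwise distinct.\<close>

fun divdiff_rec :: "(real \<Rightarrow> real) \<Rightarrow> (nat \<Rightarrow> real) \<Rightarrow> nat \<Rightarrow> nat \<Rightarrow> real" where
  "divdiff_rec f z i 0 = f (z i)"
| "divdiff_rec f z i (Suc k) =
     (divdiff_rec f z i k - divdiff_rec f z (Suc i) k) / (z i - z (i + Suc k))"

text \<open>If some nodes coincide, the value is the limit along tuples of pairwise distinct nodes
  tending to the given tuple. Convergence in \<open>nat \<Rightarrow> real\<close> is coordinatewise, and only the
  coordinates in \<open>{1..n}\<close> enter. Here \<open>n \<ge> 1\<close>.\<close>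

definition divided_difference :: "(real \<Rightarrow> real) \<Rightarrow> nat \<Rightarrow> (nat \<Rightarrow> real) \<Rightarrow> real" where
  "divided_difference f n z =
     (if inj_on z {1..n} then divdiff_rec f z 1 (n - 1)
      else Lim (at z within {w. inj_on w {1..n}}) (\<lambda>w. divdiff_rec f w 1 (n - 1)))"

end

theory Submission
  imports Defs
begin

text \<open>
  Part (i) is differentiation under the integral sign. With \<open>s = d n \<alpha> m j + 1\<close>, a derivative in
  \<open>z\<^sub>l\<close> replaces the kernel \<open>(1 - \<Sum>\<^sub>l z\<^sub>l u\<^sub>l) powr (- s)\<close> by \<open>s * u\<^sub>l\<close> times the kernel with exponent
  \<open>s + 1\<close>. The factor \<open>s\<close> goes into the Gamma function and \<open>u\<^sub>l\<close> into the weight \<open>\<omega>\<close>, so that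
  \<open>\<partial>H\<^sub>\<alpha>/\<partial>z\<^sub>l\<close> is \<open>\<alpha>\<^sub>l\<close> times \<open>H\<close> with the index \<open>\<alpha>\<^sub>l\<close> raised by one (\<open>DERIV_H\<close>). Starting from index
  \<open>1\<close>, the derivatives of order \<open>\<alpha>\<^sub>l - 1\<close> collect the factors \<open>(\<alpha>\<^sub>l - 1)!\<close>. The interchange is
  legitimate because \<open>1 - \<Sum>\<^sub>l z\<^sub>l u\<^sub>l\<close> is bounded away from \<open>0\<close> on the simplex, locally uniformly
  in \<open>z\<close>.

  Part (ii) compares two recursions in the number of nodes. For fixed \<open>s\<close> and a finite set \<open>I\<close> of
  nodes let \<open>K\<^sub>k(I)\<close> be the integral of \<open>(1 - \<Sum> u\<^sub>l)\<^sup>k / k!\<close> times the kernel over the simplex with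
  coordinates in \<open>I\<close>. Then, for distinct \<open>p\<close> and \<open>q\<close> outside \<open>J\<close>,
  \<open>(z\<^sub>p - z\<^sub>q) K\<^sub>k(J \<union> {p, q}) = z\<^sub>p K\<^bsub>k+1\<^esub>(J \<union> {p}) - z\<^sub>q K\<^bsub>k+1\<^esub>(J \<union> {q})\<close>
  (\<open>simplex_power_integral_difference\<close>): with the other coordinates frozen, this is an identity
  for an integral over a triangle, which a shear and an integration by parts reduce to the
  fundamental theorem of calculus. On the other hand the divided differences of \<open>t h(t)\<close> satisfy
  \<open>(z\<^sub>1 - z\<^sub>n) (t h)[z\<^sub>1, \<dots>, z\<^sub>n] = z\<^sub>1 h[z\<^sub>1, \<dots>, z\<^bsub>n-1\<^esub>] - z\<^sub>n h[z\<^sub>2, \<dots>, z\<^sub>n]\<close>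
  (\<open>divdiff_rec_mult_node\<close>). So the power \<open>t\<^bsup>n-1\<^esup>\<close> in the statement supplies one factor \<open>t\<close> for
  each step, and the claim for distinct nodes follows by induction. It extends to coinciding nodes
  because the integral is continuous in \<open>z\<close>.
\<close>

section \<open>Limits and derivatives under the integral sign\<close>

lemma tendsto_integral_dominated:
  fixes F :: "'a::first_countable_topology \<Rightarrow> 'b \<Rightarrow> real"
  assumes lim: "\<And>u. u \<in> space M \<Longrightarrow> ((\<lambda>x. F x u) \<longlongrightarrow> G u) (at a within S)"
    and dom: "\<forall>\<^sub>F x in at a within S. F x \<in> borel_measurable M \<and> (\<forall>u\<in>space M. \<bar>F x u\<bar> \<le> B u)"
    and G: "G \<in> borel_measurable M" and B: "integrable M B"
  shows "((\<lambda>x. \<integral>u. F x u \<partial>M) \<longlongrightarrow> (\<integral>u. G u \<partial>M)) (at a within S)"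
  unfolding tendsto_at_iff_sequentially
proof (intro allI impI)
  fix X assume X: "\<forall>i. X i \<in> S - {a}" "X \<longlonglongrightarrow> a"
  have filt: "filterlim X (at a within S) sequentially"
    using X by (auto simp: filterlim_at)
  from filterlim_iff[THEN iffD1, OF filt, rule_format, OF dom]
  obtain N where N: "\<And>i. i \<ge> N \<Longrightarrow> F (X i) \<in> borel_measurable M"
      "\<And>i u. i \<ge> N \<Longrightarrow> u \<in> space M \<Longrightarrow> \<bar>F (X i) u\<bar> \<le> B u"
    by (auto simp: eventually_sequentially)
  have "(\<lambda>i. \<integral>u. F (X (i + N)) u \<partial>M) \<longlonglongrightarrow> (\<integral>u. G u \<partial>M)"
  proof (rule integral_dominated_convergence[where w = B])
    show "AE u in M. (\<lambda>i. F (X (i + N)) u) \<longlonglongrightarrow> G u"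
    proof (rule AE_I2)
      fix u assume "u \<in> space M"
      from filterlim_compose[OF lim[OF this] filt]
      show "(\<lambda>i. F (X (i + N)) u) \<longlonglongrightarrow> G u"
        by (rule LIMSEQ_ignore_initial_segment)
    qed
  qed (use N G B in auto)
  then show "((\<lambda>x. \<integral>u. F x u \<partial>M) \<circ> X) \<longlonglongrightarrow> (\<integral>u. G u \<partial>M)"
    unfolding o_def by (rule LIMSEQ_offset)
qed

text \<open>
  By the mean value theorem a bound on the derivative in the parameter bounds the difference
  quotients, so the derivative is a dominated limit of integrals.
\<close>

lemma DERIV_integral_dominated:
  fixes F F' :: "real \<Rightarrow> 'b \<Rightarrow> real"
  assumes "e > 0"
    and deriv: "\<And>t u. \<bar>t - a\<bar> < e \<Longrightarrow> u \<in> space M \<Longrightarrow>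
                  ((\<lambda>t. F t u) has_real_derivative F' t u) (at t)"
    and dom: "\<And>t u. \<bar>t - a\<bar> < e \<Longrightarrow> u \<in> space M \<Longrightarrow> \<bar>F' t u\<bar> \<le> B u"
    and F: "\<And>t. \<bar>t - a\<bar> < e \<Longrightarrow> integrable M (F t)"
    and F': "F' a \<in> borel_measurable M" and B: "integrable M B"
  shows "((\<lambda>t. \<integral>u. F t u \<partial>M) has_real_derivative (\<integral>u. F' a u \<partial>M)) (at a)"
proof -
  have near: "\<forall>\<^sub>F y in at a. \<bar>y - a\<bar> < e \<and> y \<noteq> a"
    using \<open>e > 0\<close> by (auto simp: eventually_at dist_real_def)
  have "((\<lambda>y. \<integral>u. (F y u - F a u) / (y - a) \<partial>M) \<longlongrightarrow> (\<integral>u. F' a u \<partial>M)) (at a)"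
  proof (rule tendsto_integral_dominated[OF _ _ F' B])
    show "((\<lambda>y. (F y u - F a u) / (y - a)) \<longlongrightarrow> F' a u) (at a)" if "u \<in> space M" for u
      using deriv[of a u] that \<open>e > 0\<close> by (simp add: has_field_derivative_iff)
    show "\<forall>\<^sub>F y in at a. (\<lambda>u. (F y u - F a u) / (y - a)) \<in> borel_measurable M \<and>
            (\<forall>u\<in>space M. \<bar>(F y u - F a u) / (y - a)\<bar> \<le> B u)"
      using near
    proof (eventually_elim, intro conjI ballI)
      fix y assume y: "\<bar>y - a\<bar> < e \<and> y \<noteq> a"
      show "(\<lambda>u. (F y u - F a u) / (y - a)) \<in> borel_measurable M"
        using F[of y] F[of a] y \<open>e > 0\<close> by (auto dest: borel_measurable_integrable)
      fix u assume u: "u \<in> space M"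
      have "norm (F y u - F a u) \<le> B u * norm (y - a)"
      proof (rule field_differentiable_bound[where S = "{a-e<..<a+e}" and f' = "\<lambda>t. F' t u"])
        fix t assume "t \<in> {a-e<..<a+e}"
        then have "\<bar>t - a\<bar> < e" by auto
        with deriv[of t u] dom[of t u] u
        show "((\<lambda>t. F t u) has_field_derivative F' t u) (at t within {a-e<..<a+e})"
          "norm (F' t u) \<le> B u"
          by (auto intro: DERIV_subset)
      qed (use y \<open>e > 0\<close> in \<open>auto simp: abs_less_iff\<close>)
      then show "\<bar>(F y u - F a u) / (y - a)\<bar> \<le> B u"
        using y by (simp add: abs_divide divide_le_eq)
    qed
  qed
  then show ?thesis
    unfolding has_field_derivative_iff
  proof (rule Lim_transform_eventually)
    show "\<forall>\<^sub>F y in at a. (\<integral>u. (F y u - F a u) / (y - a) \<partial>M) =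
            ((\<integral>u. F y u \<partial>M) - (\<integral>u. F a u \<partial>M)) / (y - a)"
      using near by eventually_elim (use F \<open>e > 0\<close> in \<open>simp add: Bochner_Integration.integral_diff\<close>)
  qed
qed

section \<open>Integrals over the standard simplex\<close>

text \<open>
  An arbitrary finite set of nodes is allowed as index set, since the recursion behind the divided
  differences removes one or the other end of an interval of nodes.
\<close>

definition unit_simplex :: "nat set \<Rightarrow> (nat \<Rightarrow> real) set" where
  "unit_simplex I = {u \<in> I \<rightarrow>\<^sub>E {0..}. (\<Sum>l\<in>I. u l) \<le> 1}"

text \<open>
  The weight \<open>g\<close> is left open: part (i) needs \<open>\<omega>\<close>, part (ii) a power of the slack
  \<open>1 - (\<Sum>l\<in>I. u l)\<close>.
\<close>

definition simplex_integral ::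
  "nat set \<Rightarrow> ((nat \<Rightarrow> real) \<Rightarrow> real) \<Rightarrow> real \<Rightarrow> (nat \<Rightarrow> real) \<Rightarrow> real" where
  "simplex_integral I g s z =
     (LINT u:unit_simplex I|(\<Pi>\<^sub>M l\<in>I. lborel). g u * (1 - (\<Sum>l\<in>I. z l * u l)) powr (- s))"

interpretation lborel_product: product_sigma_finite "\<lambda>_::nat. lborel :: real measure"
  by standard

lemma unit_simplexD:
  assumes "u \<in> unit_simplex I"
  shows "\<And>l. l \<in> I \<Longrightarrow> 0 \<le> u l" and "(\<Sum>l\<in>I. u l) \<le> 1"
  using assms by (auto simp: unit_simplex_def PiE_iff)

lemma unit_simplex_le_1:
  assumes "u \<in> unit_simplex I" "finite I" "l \<in> I"
  shows "u l \<le> 1"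
  using member_le_sum[of l I u] unit_simplexD[OF assms(1)] assms(2,3) by force

lemma sets_unit_simplex [measurable]:
  assumes "finite I"
  shows "unit_simplex I \<in> sets (\<Pi>\<^sub>M l\<in>I. lborel)"
proof -
  have "unit_simplex I = {u \<in> space (\<Pi>\<^sub>M l\<in>I. lborel). (\<forall>l\<in>I. 0 \<le> u l) \<and> (\<Sum>l\<in>I. u l) \<le> 1}"
    by (auto simp: unit_simplex_def space_PiM PiE_iff)
  also have "\<dots> \<in> sets (\<Pi>\<^sub>M l\<in>I. lborel)"
    using assms by measurable
  finally show ?thesis .
qed

lemma emeasure_unit_simplex_finite:
  assumes "finite I"
  shows "emeasure (\<Pi>\<^sub>M l\<in>I. lborel) (unit_simplex I) < \<infinity>"
proof -
  have "unit_simplex I \<subseteq> (\<Pi>\<^sub>E l\<in>I. {0..1::real})"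
    using unit_simplex_le_1[OF _ assms] by (auto simp: unit_simplex_def PiE_iff extensional_def)
  then have "emeasure (\<Pi>\<^sub>M l\<in>I. lborel) (unit_simplex I) \<le> emeasure (\<Pi>\<^sub>M l\<in>I. lborel) (\<Pi>\<^sub>E l\<in>I. {0..1::real})"
    by (rule emeasure_mono) (use assms in \<open>auto intro!: sets_PiM_I_finite\<close>)
  also have "\<dots> = (\<Prod>l\<in>I. emeasure lborel {0..1::real})"
    using assms by (intro lborel_product.emeasure_PiM) auto
  finally show ?thesis by (auto simp: le_less_trans)
qed

text \<open>
  On the simplex \<open>\<Sum>l\<in>I. w l * u l\<close> is a convex combination of \<open>0\<close> and the numbers \<open>w l\<close>, so
  it stays away from \<open>1\<close>, uniformly for \<open>w\<close> near \<open>z\<close>. This makes every power of the base, of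
  whatever sign of the exponent, bounded locally uniformly in \<open>z\<close>.
\<close>

lemma kernel_base_bounds:
  assumes "finite I" "\<forall>l\<in>I. z l < 1"
  obtains \<delta> D :: real where "\<delta> > 0"
    and "\<And>w. \<forall>l\<in>I. \<bar>w l - z l\<bar> < \<delta> \<Longrightarrow> \<forall>l\<in>I. w l < 1"
    and "\<And>w u. \<forall>l\<in>I. \<bar>w l - z l\<bar> < \<delta> \<Longrightarrow> u \<in> unit_simplex I \<Longrightarrow>
           \<delta> \<le> 1 - (\<Sum>l\<in>I. w l * u l) \<and> 1 - (\<Sum>l\<in>I. w l * u l) \<le> D"
proof -
  \<comment> \<open>With \<open>M\<close> the largest of \<open>0\<close> and the \<open>z l\<close>, moving each node by less than half the gap
    \<open>1 - M\<close> leaves the other half.\<close>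
  define M where "M = Max (insert 0 (z ` I))"
  define \<delta> where "\<delta> = (1 - M) / 2"
  have M: "0 \<le> M" "M < 1" "\<And>l. l \<in> I \<Longrightarrow> z l \<le> M"
    using assms unfolding M_def by auto
  have \<delta>: "\<delta> > 0" "M + \<delta> = 1 - \<delta>" using M by (auto simp: \<delta>_def field_simps)
  define C where "C = (\<Sum>l\<in>I. \<bar>z l\<bar>) + \<delta>"
  have C: "C \<ge> 0" unfolding C_def using \<delta> by (intro add_nonneg_nonneg sum_nonneg) auto
  show ?thesis
  proof (rule that[of \<delta> "1 + C"])
    fix w assume w: "\<forall>l\<in>I. \<bar>w l - z l\<bar> < \<delta>"
    show "\<forall>l\<in>I. w l < 1"
    proof
      fix l assume "l \<in> I"
      with w M(3) have "\<bar>w l - z l\<bar> < \<delta>" "z l \<le> M" by auto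
      then show "w l < 1" using \<delta> by linarith
    qed
  next
    fix w u assume w: "\<forall>l\<in>I. \<bar>w l - z l\<bar> < \<delta>" and u: "u \<in> unit_simplex I"
    note u = unit_simplexD[OF u]
    have "(\<Sum>l\<in>I. w l * u l) \<le> (\<Sum>l\<in>I. (1 - \<delta>) * u l)"
    proof (intro sum_mono mult_right_mono u(1))
      fix l assume "l \<in> I"
      from w[rule_format, OF this] M(3)[OF this] \<delta> show "w l \<le> 1 - \<delta>" by linarith
    qed
    also have "\<dots> = (1 - \<delta>) * (\<Sum>l\<in>I. u l)" by (simp add: sum_distrib_left)
    also have "\<dots> \<le> (1 - \<delta>) * 1" using u(2) \<delta> M by (intro mult_left_mono) auto
    finally have 1: "\<delta> \<le> 1 - (\<Sum>l\<in>I. w l * u l)" by simp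
    have "(\<Sum>l\<in>I. - C * u l) \<le> (\<Sum>l\<in>I. w l * u l)"
    proof (intro sum_mono mult_right_mono u(1))
      fix l assume "l \<in> I"
      from w[rule_format, OF this] member_le_sum[OF this, of "\<lambda>l. \<bar>z l\<bar>"] assms(1) show "- C \<le> w l"
        unfolding C_def by force
    qed
    moreover have "(\<Sum>l\<in>I. - C * u l) = - (C * (\<Sum>l\<in>I. u l))"
      by (simp add: sum_distrib_left sum_negf)
    moreover have "C * (\<Sum>l\<in>I. u l) \<le> C * 1" using u(2) C by (intro mult_left_mono)
    ultimately show "\<delta> \<le> 1 - (\<Sum>l\<in>I. w l * u l) \<and> 1 - (\<Sum>l\<in>I. w l * u l) \<le> 1 + C"
      using 1 by linarith
  qed (rule \<delta>)
qed

text \<open>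
  Adding the two end values gives one bound for increasing and decreasing powers alike.
\<close>

lemma powr_le_powr_endpoints:
  fixes x p :: real
  assumes "0 < \<delta>" "\<delta> \<le> x" "x \<le> D"
  shows "x powr p \<le> \<delta> powr p + D powr p"
proof (cases "p \<ge> 0")
  case True
  then have "x powr p \<le> D powr p" using assms by (intro powr_mono2) auto
  then show ?thesis by (simp add: add_increasing)
next
  case False
  then have "x powr p \<le> \<delta> powr p" using assms by (intro powr_mono2') auto
  then show ?thesis by (simp add: add_increasing2)
qed

lemma kernel_base_pos:
  assumes "finite I" "\<forall>l\<in>I. z l < 1" "u \<in> unit_simplex I"
  shows "0 < 1 - (\<Sum>l\<in>I. z l * u l)"
proof (rule kernel_base_bounds[OF assms(1,2)])
  fix \<delta> D :: real
  assume "\<delta> > 0" and "\<And>w u. \<forall>l\<in>I. \<bar>w l - z l\<bar> < \<delta> \<Longrightarrow> u \<in> unit_simplex I \<Longrightarrow>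
           \<delta> \<le> 1 - (\<Sum>l\<in>I. w l * u l) \<and> 1 - (\<Sum>l\<in>I. w l * u l) \<le> D"
  from this(1) this(2)[of z u] assms(3) show ?thesis by simp
qed

definition bounded_weight :: "nat set \<Rightarrow> ((nat \<Rightarrow> real) \<Rightarrow> real) \<Rightarrow> bool" where
  "bounded_weight I g \<longleftrightarrow> g \<in> borel_measurable (\<Pi>\<^sub>M l\<in>I. lborel) \<and> (\<exists>C. \<forall>u\<in>unit_simplex I. \<bar>g u\<bar> \<le> C)"

definition simplex_integrand ::
  "nat set \<Rightarrow> ((nat \<Rightarrow> real) \<Rightarrow> real) \<Rightarrow> real \<Rightarrow> (nat \<Rightarrow> real) \<Rightarrow> (nat \<Rightarrow> real) \<Rightarrow> real" where
  "simplex_integrand I g s z u =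
     indicator (unit_simplex I) u * (g u * (1 - (\<Sum>l\<in>I. z l * u l)) powr (- s))"

lemma simplex_integral_eq:
  "simplex_integral I g s z = (\<integral>u. simplex_integrand I g s z u \<partial>(\<Pi>\<^sub>M l\<in>I. lborel))"
  by (simp add: simplex_integral_def simplex_integrand_def set_lebesgue_integral_def)

lemma measurable_simplex_integrand:
  assumes "finite I" "bounded_weight I g"
  shows "simplex_integrand I g s z \<in> borel_measurable (\<Pi>\<^sub>M l\<in>I. lborel)"
proof -
  from assms(2) have [measurable]: "g \<in> borel_measurable (\<Pi>\<^sub>M l\<in>I. lborel)"
    by (auto simp: bounded_weight_def)
  note sets_unit_simplex[OF assms(1), measurable]
  show ?thesis
    unfolding simplex_integrand_def by measurable
qed

text \<open>
  One constant dominates the integrands for all nodes near \<open>z\<close>. This is the hypothesis of both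
  the continuity and the differentiation lemma.
\<close>

lemma simplex_integrand_dominated:
  assumes "finite I" "bounded_weight I g" "\<forall>l\<in>I. z l < 1"
  obtains \<delta> B where "\<delta> > 0"
    and "\<And>w. \<forall>l\<in>I. \<bar>w l - z l\<bar> < \<delta> \<Longrightarrow> \<forall>l\<in>I. w l < 1"
    and "\<And>w u. \<forall>l\<in>I. \<bar>w l - z l\<bar> < \<delta> \<Longrightarrow>
           \<bar>simplex_integrand I g s w u\<bar> \<le> B * indicator (unit_simplex I) u"
proof -
  from assms(2) obtain C where C: "\<And>u. u \<in> unit_simplex I \<Longrightarrow> \<bar>g u\<bar> \<le> C"
    by (auto simp: bounded_weight_def)
  obtain \<delta> D where \<delta>: "\<delta> > 0" and
    lt: "\<And>w. \<forall>l\<in>I. \<bar>w l - z l\<bar> < \<delta> \<Longrightarrow> \<forall>l\<in>I. w l < 1" and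
    D: "\<And>w u. \<forall>l\<in>I. \<bar>w l - z l\<bar> < \<delta> \<Longrightarrow> u \<in> unit_simplex I \<Longrightarrow>
           \<delta> \<le> 1 - (\<Sum>l\<in>I. w l * u l) \<and> 1 - (\<Sum>l\<in>I. w l * u l) \<le> D"
    by (rule kernel_base_bounds[OF assms(1,3)]) blast
  have "\<bar>simplex_integrand I g s w u\<bar> \<le> C * (\<delta> powr - s + D powr - s) * indicator (unit_simplex I) u"
    if w: "\<forall>l\<in>I. \<bar>w l - z l\<bar> < \<delta>" for w u
  proof (cases "u \<in> unit_simplex I")
    case True
    have "\<bar>g u\<bar> * (1 - (\<Sum>l\<in>I. w l * u l)) powr (- s) \<le> C * (\<delta> powr - s + D powr - s)"
      using C[OF True] D[OF w True] \<delta> powr_le_powr_endpoints[of \<delta>]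
      by (intro mult_mono) auto
    then show ?thesis using True by (simp add: simplex_integrand_def abs_mult)
  qed (simp add: simplex_integrand_def)
  with \<delta> lt show ?thesis by (rule that)
qed

lemma integrable_simplex_bound:
  assumes "finite I"
  shows "integrable (\<Pi>\<^sub>M l\<in>I. lborel) (\<lambda>u. B * indicator (unit_simplex I) u :: real)"
  using assms emeasure_unit_simplex_finite[OF assms]
  by (intro integrable_mult_right integrable_real_indicator) (auto simp: sets_unit_simplex)

lemma integrable_simplex_integrand:
  assumes "finite I" "bounded_weight I g" "\<forall>l\<in>I. z l < 1"
  shows "integrable (\<Pi>\<^sub>M l\<in>I. lborel) (simplex_integrand I g s z)"
proof -
  obtain \<delta> B where "\<delta> > 0" and
    "\<And>w u. \<forall>l\<in>I. \<bar>w l - z l\<bar> < \<delta> \<Longrightarrow>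
       \<bar>simplex_integrand I g s w u\<bar> \<le> B * indicator (unit_simplex I) u"
    by (rule simplex_integrand_dominated[OF assms, where s = s]) blast
  from this(1) this(2)[of z] have B: "norm (simplex_integrand I g s z u) \<le> norm (B * indicator (unit_simplex I) u)" for u
    by (auto intro: order_trans[OF _ abs_ge_self])
  show ?thesis
    by (rule Bochner_Integration.integrable_bound[OF integrable_simplex_bound[of I B]
          measurable_simplex_integrand AE_I2]) (use assms B in auto)
qed

lemma tendsto_simplex_integral:
  assumes "finite I" "bounded_weight I g" "\<forall>l\<in>I. z l < 1"
  shows "((\<lambda>w. simplex_integral I g s w) \<longlongrightarrow> simplex_integral I g s z) (at z within S)"
proof -
  have coord: "((\<lambda>w. w l) \<longlongrightarrow> z l) (at z within S)" for l :: nat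
    using continuous_on_product_coordinates[of l]
    by (auto simp: continuous_on_def intro: tendsto_within_subset)
  obtain \<delta> B where "\<delta> > 0" and
    B: "\<And>w u. \<forall>l\<in>I. \<bar>w l - z l\<bar> < \<delta> \<Longrightarrow>
          \<bar>simplex_integrand I g s w u\<bar> \<le> B * indicator (unit_simplex I) u"
    by (rule simplex_integrand_dominated[OF assms, where s = s]) blast
  have near: "\<forall>\<^sub>F w in at z within S. \<forall>l\<in>I. \<bar>w l - z l\<bar> < \<delta>"
    using assms(1) tendstoD[OF coord \<open>\<delta> > 0\<close>]
    by (simp add: eventually_ball_finite_distrib dist_real_def)
  show ?thesis
    unfolding simplex_integral_eq
  proof (rule tendsto_integral_dominated[where B = "\<lambda>u. B * indicator (unit_simplex I) u"])
    show "((\<lambda>w. simplex_integrand I g s w u) \<longlongrightarrow> simplex_integrand I g s z u) (at z within S)" for u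
    proof (cases "u \<in> unit_simplex I")
      case True
      have "1 - (\<Sum>l\<in>I. z l * u l) \<noteq> 0"
        using kernel_base_pos[OF assms(1,3) True] by simp
      then show ?thesis
        unfolding simplex_integrand_def by (intro tendsto_intros coord disjI1)
    qed (simp add: simplex_integrand_def)
    show "\<forall>\<^sub>F w in at z within S.
        simplex_integrand I g s w \<in> borel_measurable (\<Pi>\<^sub>M l\<in>I. lborel) \<and>
        (\<forall>u\<in>space (\<Pi>\<^sub>M l\<in>I. lborel).
           \<bar>simplex_integrand I g s w u\<bar> \<le> B * indicator (unit_simplex I) u)"
      using near by eventually_elim (use B measurable_simplex_integrand[OF assms(1,2)] in blast)
  qed (rule measurable_simplex_integrand[OF assms(1,2)] integrable_simplex_bound[OF assms(1)])+
qed

lemma bounded_weight_mult_coordinate: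
  assumes "bounded_weight I g" "finite I" "l \<in> I"
  shows "bounded_weight I (\<lambda>u. g u * u l)"
proof -
  from assms(1) obtain C where [measurable]: "g \<in> borel_measurable (\<Pi>\<^sub>M l\<in>I. lborel)"
    and C: "\<And>u. u \<in> unit_simplex I \<Longrightarrow> \<bar>g u\<bar> \<le> C"
    by (auto simp: bounded_weight_def)
  have "\<bar>g u * u l\<bar> \<le> C" if u: "u \<in> unit_simplex I" for u
  proof -
    have "\<bar>g u\<bar> * \<bar>u l\<bar> \<le> C * 1"
      using C[OF u] unit_simplexD(1)[OF u assms(3)] unit_simplex_le_1[OF u assms(2,3)]
      by (intro mult_mono) auto
    then show ?thesis by (simp add: abs_mult)
  qed
  moreover have "(\<lambda>u. g u * u l) \<in> borel_measurable (\<Pi>\<^sub>M l\<in>I. lborel)"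
    using assms(3) by measurable
  ultimately show ?thesis by (auto simp: bounded_weight_def)
qed

text \<open>
  Differentiating \<open>(1 - (\<Sum>i\<in>I. z i * u i)) powr (- s)\<close> in \<open>z l\<close> brings down the factor
  \<open>s * u l\<close> and raises the exponent \<open>s\<close> by one; the factor \<open>u l\<close> is absorbed into the weight.
\<close>

lemma DERIV_simplex_integral:
  assumes "finite I" "bounded_weight I g" "\<forall>l\<in>I. z l < 1" "l \<in> I"
  shows "((\<lambda>t. simplex_integral I g s (z(l := t))) has_real_derivative
           s * simplex_integral I (\<lambda>u. g u * u l) (s + 1) z) (at (z l))"
proof -
  define g' where "g' = (\<lambda>u. g u * u l)"
  have g': "bounded_weight I g'"
    unfolding g'_def using assms by (intro bounded_weight_mult_coordinate)
  obtain \<delta> B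
    where "\<delta> > 0" and lt: "\<And>w. \<forall>i\<in>I. \<bar>w i - z i\<bar> < \<delta> \<Longrightarrow> \<forall>i\<in>I. w i < 1" and
      B: "\<And>w u. \<forall>i\<in>I. \<bar>w i - z i\<bar> < \<delta> \<Longrightarrow>
          \<bar>simplex_integrand I g' (s + 1) w u\<bar> \<le> B * indicator (unit_simplex I) u"
    by (rule simplex_integrand_dominated[OF assms(1) g' assms(3), where s = "s + 1"]) blast
  have near: "\<forall>i\<in>I. \<bar>(z(l := t)) i - z i\<bar> < \<delta>" if "\<bar>t - z l\<bar> < \<delta>" for t
    using that \<open>\<delta> > 0\<close> by auto
  have "((\<lambda>t. \<integral>u. simplex_integrand I g s (z(l := t)) u \<partial>(\<Pi>\<^sub>M l\<in>I. lborel)) has_real_derivative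
          (\<integral>u. s * simplex_integrand I g' (s + 1) (z(l := z l)) u \<partial>(\<Pi>\<^sub>M l\<in>I. lborel))) (at (z l))"
  proof (rule DERIV_integral_dominated[where e = \<delta> and
        F' = "\<lambda>t u. s * simplex_integrand I g' (s + 1) (z(l := t)) u" and
        B = "\<lambda>u. \<bar>s\<bar> * (B * indicator (unit_simplex I) u)"])
    fix t u assume t: "\<bar>t - z l\<bar> < \<delta>"
    note lt = lt[OF near[OF t]]
    show "((\<lambda>t. simplex_integrand I g s (z(l := t)) u) has_real_derivative
             s * simplex_integrand I g' (s + 1) (z(l := t)) u) (at t)"
    proof (cases "u \<in> unit_simplex I")
      case True
      have split: "(\<Sum>i\<in>I. (z(l := t)) i * u i) = t * u l + (\<Sum>i\<in>I - {l}. z i * u i)" for t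
        using assms(1,4) by (subst sum.remove[of _ l]) auto
      have pos: "1 - (t * u l + (\<Sum>i\<in>I - {l}. z i * u i)) > 0"
        using kernel_base_pos[OF assms(1) lt True] unfolding split by auto
      have "((\<lambda>t. 1 - (t * u l + (\<Sum>i\<in>I - {l}. z i * u i))) has_real_derivative - u l) (at t)"
        by (auto intro!: derivative_eq_intros)
      from DERIV_fun_powr[OF this pos, of "- s"]
      have "((\<lambda>t. (1 - (t * u l + (\<Sum>i\<in>I - {l}. z i * u i))) powr (- s)) has_real_derivative
              s * u l * (1 - (t * u l + (\<Sum>i\<in>I - {l}. z i * u i))) powr (- s - 1)) (at t)"
        by (simp add: mult_ac)
      from DERIV_cmult[OF this, of "g u"] show ?thesis
        using True unfolding simplex_integrand_def g'_def split by (simp add: mult_ac diff_diff_eq2)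
    qed (simp add: simplex_integrand_def)
    show "\<bar>s * simplex_integrand I g' (s + 1) (z(l := t)) u\<bar>
            \<le> \<bar>s\<bar> * (B * indicator (unit_simplex I) u)"
      unfolding abs_mult by (intro mult_left_mono B near t) auto
    show "integrable (\<Pi>\<^sub>M l\<in>I. lborel) (simplex_integrand I g s (z(l := t)))"
      using lt assms by (intro integrable_simplex_integrand) auto
  next
    show "(\<lambda>u. s * simplex_integrand I g' (s + 1) (z(l := z l)) u) \<in> borel_measurable (\<Pi>\<^sub>M l\<in>I. lborel)"
      by (intro borel_measurable_times borel_measurable_const measurable_simplex_integrand assms g')
    show "integrable (\<Pi>\<^sub>M l\<in>I. lborel) (\<lambda>u. \<bar>s\<bar> * (B * indicator (unit_simplex I) u))"
      by (intro integrable_mult_right integrable_simplex_bound assms)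
  qed (rule \<open>\<delta> > 0\<close>)
  then show ?thesis by (simp add: simplex_integral_eq g'_def)
qed

section \<open>The integral over a triangle\<close>

text \<open>
  In the coordinates \<open>\<sigma> = x + y\<close> and \<open>y\<close> the slack \<open>R - x - y\<close> depends on \<open>\<sigma>\<close> only. So after
  Fubini the inner integral contains nothing but a power of an affine function of \<open>y\<close>.
\<close>

lemma triangle_integral_shear:
  fixes p q R c s :: real and k :: nat
  assumes "0 \<le> R" "0 < c" "p * R < c" "q * R < c"
  defines "f \<equiv> \<lambda>x y. indicator {(x, y). 0 \<le> x \<and> 0 \<le> y \<and> x + y \<le> R} (x, y) *
                 ((R - x - y) ^ k * (c - p * x - q * y) powr (- s))"
  shows "(\<integral>y. \<integral>x. f x y \<partial>lborel \<partial>lborel) =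
         (\<integral>\<sigma>. indicator {0..R} \<sigma> * ((R - \<sigma>) ^ k *
            (\<integral>y. indicator {0..\<sigma>} y * (c - p * \<sigma> + (p - q) * y) powr (- s) \<partial>lborel)) \<partial>lborel)"
proof -
  define T where "T = {w :: real \<times> real. 0 \<le> fst w \<and> fst w \<le> snd w \<and> snd w \<le> R}"
  define h where "h = (\<lambda>(y, \<sigma>). (R - \<sigma>) ^ k * (c - p * \<sigma> + (p - q) * y) powr (- s))"
  have "closed T" unfolding T_def
    by (intro closed_Collect_conj closed_Collect_le continuous_intros)
  moreover have "T \<subseteq> cbox (0, 0) (R, R)" by (auto simp: T_def cbox_Pair_eq)
  ultimately have "compact T"
    using bounded_cbox bounded_subset compact_eq_bounded_closed by metis
  moreover have pos: "c - p * \<sigma> + (p - q) * y > 0" if "(y, \<sigma>) \<in> T" for y \<sigma>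
  proof (cases "R = 0")
    case True
    then have "y = 0" "\<sigma> = 0" using that by (auto simp: T_def)
    then show ?thesis using \<open>0 < c\<close> by simp
  next
    case False
    have y: "0 \<le> y" "y \<le> \<sigma>" "\<sigma> \<le> R" using that by (auto simp: T_def)
    have "R > 0" using False assms by simp
    \<comment> \<open>Up to the factor \<open>R\<close>, the base is the barycentric combination of its values \<open>c\<close>,
      \<open>c - p * R\<close>, \<open>c - q * R\<close> at the corners of the triangle.\<close>
    have "0 < (R - \<sigma>) * c + (\<sigma> - y) * (c - p * R) + y * (c - q * R)"
    proof (cases "\<sigma> < R")
      case True
      then show ?thesis using y assms by (intro add_pos_nonneg mult_pos_pos mult_nonneg_nonneg) auto
    next
      case False
      then have "\<sigma> = R" using y by simp
      show ?thesis
      proof (cases "y < \<sigma>")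
        case True
        then show ?thesis using y assms
          by (intro add_pos_nonneg add_nonneg_pos mult_pos_pos mult_nonneg_nonneg) auto
      next
        case False
        then have "y = R" using \<open>\<sigma> = R\<close> y by simp
        then show ?thesis using \<open>\<sigma> = R\<close> \<open>R > 0\<close> assms by simp
      qed
    qed
    also have "\<dots> = R * (c - p * \<sigma> + (p - q) * y)" by (simp add: algebra_simps)
    finally show ?thesis using \<open>R > 0\<close> by (simp add: zero_less_mult_iff)
  qed
  ultimately have "integrable lborel (\<lambda>w. indicator T w *\<^sub>R h w)"
    unfolding h_def case_prod_beta
    by (intro borel_integrable_compact continuous_intros) force+
  then have int: "integrable (lborel \<Otimes>\<^sub>M lborel) (\<lambda>(y, \<sigma>). indicator T (y, \<sigma>) * h (y, \<sigma>))"
    by (simp add: lborel_prod case_prod_unfold)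
  have "(\<integral>x. f x y \<partial>lborel) = (\<integral>\<sigma>. indicator T (y, \<sigma>) * h (y, \<sigma>) \<partial>lborel)" for y
    by (subst lborel_integral_real_affine[where c = 1 and t = "- y"])
       (auto intro!: Bochner_Integration.integral_cong
         simp: f_def T_def h_def indicator_def algebra_simps)
  then have "(\<integral>y. \<integral>x. f x y \<partial>lborel \<partial>lborel) = (\<integral>y. \<integral>\<sigma>. indicator T (y, \<sigma>) * h (y, \<sigma>) \<partial>lborel \<partial>lborel)"
    by simp
  also have "\<dots> = (\<integral>\<sigma>. \<integral>y. indicator T (y, \<sigma>) * h (y, \<sigma>) \<partial>lborel \<partial>lborel)"
    using int by (intro lborel_pair.Fubini_integral[symmetric]) simp
  also have "\<dots> = (\<integral>\<sigma>. indicator {0..R} \<sigma> * ((R - \<sigma>) ^ k *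
            (\<integral>y. indicator {0..\<sigma>} y * (c - p * \<sigma> + (p - q) * y) powr (- s) \<partial>lborel)) \<partial>lborel)"
  proof (rule Bochner_Integration.integral_cong[OF refl])
    fix \<sigma> :: real
    have "(\<integral>y. indicator T (y, \<sigma>) * h (y, \<sigma>) \<partial>lborel) =
      (\<integral>y. (indicator {0..R} \<sigma> * (R - \<sigma>) ^ k) *
          (indicator {0..\<sigma>} y * (c - p * \<sigma> + (p - q) * y) powr (- s)) \<partial>lborel)"
      by (intro Bochner_Integration.integral_cong) (auto simp: T_def h_def indicator_def)
    then show "(\<integral>y. indicator T (y, \<sigma>) * h (y, \<sigma>) \<partial>lborel) = indicator {0..R} \<sigma> * ((R - \<sigma>) ^ k *
            (\<integral>y. indicator {0..\<sigma>} y * (c - p * \<sigma> + (p - q) * y) powr (- s) \<partial>lborel))"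
      by (simp add: mult.assoc)
  qed
  finally show ?thesis .
qed

definition powr_antideriv :: "real \<Rightarrow> real \<Rightarrow> real" where
  "powr_antideriv s v = (if s = 1 then ln v else v powr (1 - s) / (1 - s))"

lemma DERIV_powr_antideriv:
  assumes "v > 0"
  shows "(powr_antideriv s has_real_derivative v powr (- s)) (at v)"
proof (cases "s = 1")
  case True
  then have "powr_antideriv s = ln" by (simp add: powr_antideriv_def fun_eq_iff)
  then show ?thesis
    using True assms by (auto intro!: derivative_eq_intros simp: powr_minus divide_simps)
next
  case False
  then have "powr_antideriv s = (\<lambda>v. v powr (1 - s) / (1 - s))"
    by (simp add: powr_antideriv_def fun_eq_iff)
  moreover have "((\<lambda>v. v powr (1 - s)) has_real_derivative (1 - s) * v powr (- s)) (at v)"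
    using has_real_derivative_powr[OF assms, of "1 - s"] by simp
  ultimately show ?thesis
    using DERIV_cdivide[of _ _ v UNIV "1 - s"] False by fastforce
qed

lemma DERIV_powr_antideriv_comp:
  assumes "(f has_real_derivative m) (at x)" "f x > 0"
  shows "((\<lambda>x. powr_antideriv s (f x)) has_real_derivative f x powr (- s) * m) (at x)"
  using DERIV_chain2[of "powr_antideriv s" _ f x] DERIV_powr_antideriv[OF assms(2)] assms(1) by blast

text \<open>
  Let \<open>\<Phi>\<close> be an antiderivative of \<open>v powr (- s)\<close>. The factor \<open>p - q\<close> turns the inner integral of
  the sheared form into \<open>\<Phi> (c - q * \<sigma>) - \<Phi> (c - p * \<sigma>)\<close>, which separates \<open>p\<close> from \<open>q\<close>.
  Integrating each of the two terms by parts in \<open>\<sigma>\<close> raises the power of \<open>R - \<sigma>\<close> by one and brings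
  back the power of the base, with the factor \<open>p\<close> or \<open>q\<close>. The boundary terms at \<open>0\<close> are the same
  for \<open>p\<close> and \<open>q\<close> and cancel; those at \<open>R\<close> vanish.
\<close>

lemma triangle_integral_difference:
  fixes p q R c s :: real and k :: nat
  assumes "0 \<le> R" "0 < c" "p * R < c" "q * R < c"
  shows "(p - q) * (\<integral>y. \<integral>x. indicator {(x, y). 0 \<le> x \<and> 0 \<le> y \<and> x + y \<le> R} (x, y) *
            ((R - x - y) ^ k * (c - p * x - q * y) powr (- s)) \<partial>lborel \<partial>lborel) =
         (p * (\<integral>x. indicator {0..R} x * ((R - x) ^ Suc k * (c - p * x) powr (- s)) \<partial>lborel) -
          q * (\<integral>x. indicator {0..R} x * ((R - x) ^ Suc k * (c - q * x) powr (- s)) \<partial>lborel)) / Suc k"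
proof -
  define \<Phi> where "\<Phi> = powr_antideriv s"
  have pos: "c - r * \<sigma> > 0" if "0 \<le> \<sigma>" "\<sigma> \<le> R" "r * R < c" for r \<sigma>
  proof (cases "r \<ge> 0")
    case True
    then have "r * \<sigma> \<le> r * R" using that by (intro mult_left_mono)
    then show ?thesis using that by simp
  next
    case False
    then have "r * \<sigma> \<le> 0" using that by (simp add: mult_nonpos_nonneg)
    then show ?thesis using assms(2) by linarith
  qed
  have inner: "(p - q) * (\<integral>y. indicator {0..\<sigma>} y * (c - p * \<sigma> + (p - q) * y) powr (- s) \<partial>lborel) =
      \<Phi> (c - q * \<sigma>) - \<Phi> (c - p * \<sigma>)" if \<sigma>: "\<sigma> \<in> {0..R}" for \<sigma>
  proof -
    have pos': "c - p * \<sigma> + (p - q) * y > 0" if y: "0 \<le> y" "y \<le> \<sigma>" for y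
    proof (cases "p \<ge> q")
      case True
      then have "(p - q) * y \<ge> 0" using y by simp
      then show ?thesis using pos[of \<sigma> p] \<sigma> assms by simp
    next
      case False
      then have "(p - q) * \<sigma> \<le> (p - q) * y" using y by (intro mult_left_mono_neg) auto
      then show ?thesis using pos[of \<sigma> q] \<sigma> assms by (simp add: algebra_simps)
    qed
    have "(\<integral>y. ((p - q) * (c - p * \<sigma> + (p - q) * y) powr (- s)) * indicator {0..\<sigma>} y \<partial>lborel) =
        \<Phi> (c - p * \<sigma> + (p - q) * \<sigma>) - \<Phi> (c - p * \<sigma> + (p - q) * 0)"
    proof (rule integral_FTC_Icc_real)
      fix y assume y: "0 \<le> y" "y \<le> \<sigma>"
      show "((\<lambda>y. \<Phi> (c - p * \<sigma> + (p - q) * y)) has_real_derivative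
              (p - q) * (c - p * \<sigma> + (p - q) * y) powr (- s)) (at y)"
        unfolding \<Phi>_def
        by (rule DERIV_cong, rule DERIV_powr_antideriv_comp[where m = "p - q"])
           (use pos'[OF y] in \<open>auto intro!: derivative_eq_intros\<close>)
      show "isCont (\<lambda>y. (p - q) * (c - p * \<sigma> + (p - q) * y) powr (- s)) y"
        using pos'[OF y] by (intro continuous_intros) auto
    qed (use \<sigma> in auto)
    also have "(\<integral>y. ((p - q) * (c - p * \<sigma> + (p - q) * y) powr (- s)) * indicator {0..\<sigma>} y \<partial>lborel) =
        (p - q) * (\<integral>y. indicator {0..\<sigma>} y * (c - p * \<sigma> + (p - q) * y) powr (- s) \<partial>lborel)"
      by (simp add: mult_ac flip: Bochner_Integration.integral_mult_right_zero)
    finally show ?thesis by (simp add: algebra_simps)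
  qed
  define J where "J = (\<lambda>r. (\<integral>x. indicator {0..R} x * ((R - x) ^ Suc k * (c - r * x) powr (- s)) \<partial>lborel))"
  define L where "L = (\<lambda>r. (\<integral>x. indicator {0..R} x * ((R - x) ^ k * \<Phi> (c - r * x)) \<partial>lborel))"
  have contPhi: "isCont (\<lambda>x. \<Phi> (c - r * x)) x" if "r * R < c" "0 \<le> x" "x \<le> R" for r x
    unfolding \<Phi>_def
    by (rule DERIV_isCont, rule DERIV_powr_antideriv_comp[where m = "- r"])
       (use pos[OF that(2,3,1)] in \<open>auto intro!: derivative_eq_intros\<close>)
  have intL: "integrable lborel (\<lambda>x. indicator {0..R} x * ((R - x) ^ k * \<Phi> (c - r * x)))" if "r * R < c" for r
    using borel_integrable_compact[of "{0..R}" "\<lambda>x. (R - x) ^ k * \<Phi> (c - r * x)"] contPhi[OF that]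
    by (fastforce intro!: continuous_at_imp_continuous_on continuous_intros)
  have intJ: "integrable lborel (\<lambda>x. indicator {0..R} x * ((R - x) ^ Suc k * (c - r * x) powr (- s)))" if "r * R < c" for r
    using borel_integrable_compact[of "{0..R}" "\<lambda>x. (R - x) ^ Suc k * (c - r * x) powr (- s)"] pos[OF _ _ that]
    by (fastforce intro!: continuous_intros)
  \<comment> \<open>Integration by parts, as the fundamental theorem for \<open>(R - x) ^ Suc k * \<Phi> (c - r * x)\<close>.\<close>
  have parts: "r * J r = R ^ Suc k * \<Phi> c - Suc k * L r" if r: "r * R < c" for r
  proof -
    have "(\<integral>x. (- (Suc k * ((R - x) ^ k * \<Phi> (c - r * x))) - r * ((R - x) ^ Suc k * (c - r * x) powr (- s))) *
             indicator {0..R} x \<partial>lborel) = (R - R) ^ Suc k * \<Phi> (c - r * R) - (R - 0) ^ Suc k * \<Phi> (c - r * 0)"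
    proof (rule integral_FTC_Icc_real)
      fix x assume x: "0 \<le> x" "x \<le> R"
      have "((\<lambda>x. \<Phi> (c - r * x)) has_real_derivative (c - r * x) powr (- s) * (- r)) (at x)"
        unfolding \<Phi>_def
        by (rule DERIV_powr_antideriv_comp)
           (use pos[OF x r] in \<open>auto intro!: derivative_eq_intros\<close>)
      moreover have "((\<lambda>x. (R - x) ^ Suc k) has_real_derivative (1 + real k) * (- 1 * (R - x) ^ k)) (at x)"
        by (intro DERIV_power_Suc) (auto intro!: derivative_eq_intros)
      ultimately show "((\<lambda>x. (R - x) ^ Suc k * \<Phi> (c - r * x)) has_real_derivative
         - (Suc k * ((R - x) ^ k * \<Phi> (c - r * x))) - r * ((R - x) ^ Suc k * (c - r * x) powr (- s))) (at x)"
        by (rule DERIV_cong[OF DERIV_mult[rotated]]) (simp add: algebra_simps)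
      show "isCont (\<lambda>x. - (Suc k * ((R - x) ^ k * \<Phi> (c - r * x))) - r * ((R - x) ^ Suc k * (c - r * x) powr (- s))) x"
        using pos[OF x r] contPhi[OF r x] by (intro continuous_intros) auto
    qed (use assms in auto)
    also have "(\<integral>x. (- (Suc k * ((R - x) ^ k * \<Phi> (c - r * x))) - r * ((R - x) ^ Suc k * (c - r * x) powr (- s))) *
             indicator {0..R} x \<partial>lborel) = (\<integral>x. - (Suc k * (indicator {0..R} x * ((R - x) ^ k * \<Phi> (c - r * x))))
              - r * (indicator {0..R} x * ((R - x) ^ Suc k * (c - r * x) powr (- s))) \<partial>lborel)"
      by (intro Bochner_Integration.integral_cong) (auto simp: algebra_simps)
    also have "\<dots> = - (Suc k * L r) - r * J r"
      unfolding L_def J_def using intL[OF r] intJ[OF r]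
      by (subst Bochner_Integration.integral_diff) (simp_all del: power_Suc)
    finally show ?thesis by simp
  qed
  have "(p - q) * (\<integral>y. \<integral>x. indicator {(x, y). 0 \<le> x \<and> 0 \<le> y \<and> x + y \<le> R} (x, y) *
            ((R - x - y) ^ k * (c - p * x - q * y) powr (- s)) \<partial>lborel \<partial>lborel) =
      (\<integral>\<sigma>. (p - q) * (indicator {0..R} \<sigma> * ((R - \<sigma>) ^ k *
            (\<integral>y. indicator {0..\<sigma>} y * (c - p * \<sigma> + (p - q) * y) powr (- s) \<partial>lborel))) \<partial>lborel)"
    by (subst triangle_integral_shear[OF assms]) simp
  also have "\<dots> = (\<integral>\<sigma>. indicator {0..R} \<sigma> * ((R - \<sigma>) ^ k * \<Phi> (c - q * \<sigma>)) -
                        indicator {0..R} \<sigma> * ((R - \<sigma>) ^ k * \<Phi> (c - p * \<sigma>)) \<partial>lborel)"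
  proof (rule Bochner_Integration.integral_cong[OF refl])
    fix \<sigma> :: real
    show "(p - q) * (indicator {0..R} \<sigma> * ((R - \<sigma>) ^ k *
            (\<integral>y. indicator {0..\<sigma>} y * (c - p * \<sigma> + (p - q) * y) powr (- s) \<partial>lborel))) =
        indicator {0..R} \<sigma> * ((R - \<sigma>) ^ k * \<Phi> (c - q * \<sigma>)) -
        indicator {0..R} \<sigma> * ((R - \<sigma>) ^ k * \<Phi> (c - p * \<sigma>))"
    proof (cases "\<sigma> \<in> {0..R}")
      case True
      then show ?thesis
        using arg_cong[OF inner[OF True], of "\<lambda>v. (R - \<sigma>) ^ k * v"] by (simp add: algebra_simps)
    qed auto
  qed
  also have "\<dots> = L q - L p"
    unfolding L_def using intL assms by (subst Bochner_Integration.integral_diff) auto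
  also have "\<dots> = (p * J p - q * J q) / Suc k"
    using parts[OF assms(3)] parts[OF assms(4)] by (simp add: field_simps)
  finally show ?thesis unfolding J_def .
qed

section \<open>Removing a node from the simplex\<close>

text \<open>
  The Fubini companion of the library rule for splitting off one coordinate of a product integral:
  the partial integrals are themselves integrable, so a second coordinate can be split off, and
  differences of partial integrals can be integrated termwise.
\<close>

lemma integrable_product_insert:
  fixes f :: "(nat \<Rightarrow> real) \<Rightarrow> real"
  assumes I: "finite I" "i \<notin> I"
    and f: "integrable (\<Pi>\<^sub>M l\<in>insert i I. lborel) f"
  shows "integrable (\<Pi>\<^sub>M l\<in>I. lborel) (\<lambda>v. \<integral>x. f (v(i := x)) \<partial>lborel)"
proof -
  interpret I: finite_product_sigma_finite "\<lambda>_::nat. lborel :: real measure" I by standard fact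
  interpret J: finite_product_sigma_finite "\<lambda>_::nat. lborel :: real measure" "{i}" by standard simp
  interpret P: pair_sigma_finite "\<Pi>\<^sub>M l\<in>I. lborel :: real measure" "\<Pi>\<^sub>M l\<in>{i}. lborel :: real measure" ..
  have "integrable ((\<Pi>\<^sub>M l\<in>I. lborel) \<Otimes>\<^sub>M (\<Pi>\<^sub>M l\<in>{i}. lborel)) (\<lambda>w. f (merge I {i} w))"
    by (rule integrable_distr[OF measurable_merge], subst lborel_product.distr_merge)
       (use I f in auto)
  from P.integrable_fst'[OF this]
  have "integrable (\<Pi>\<^sub>M l\<in>I. lborel) (\<lambda>v. \<integral>y. f (merge I {i} (v, y)) \<partial>(\<Pi>\<^sub>M l\<in>{i}. lborel))" .
  also have "?this \<longleftrightarrow> ?thesis"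
  proof (rule Bochner_Integration.integrable_cong[OF refl])
    fix v assume v: "v \<in> space (\<Pi>\<^sub>M l\<in>I. lborel :: real measure)"
    have meas: "(\<lambda>x. f (v(i := x))) \<in> borel_measurable lborel"
      using measurable_comp[OF measurable_component_update[OF v I(2)] borel_measurable_integrable[OF f]]
      by (simp add: comp_def)
    have "(\<integral>y. f (merge I {i} (v, y)) \<partial>(\<Pi>\<^sub>M l\<in>{i}. lborel)) = (\<integral>y. f (v(i := y i)) \<partial>(\<Pi>\<^sub>M l\<in>{i}. lborel))"
      using v I(2)
      by (intro Bochner_Integration.integral_cong[OF refl] arg_cong[where f = f])
         (auto simp: merge_def space_PiM extensional_def PiE_def)
    also have "\<dots> = (\<integral>x. f (v(i := x)) \<partial>lborel)"
      by (rule lborel_product.product_integral_singleton[OF meas])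
    finally show "(\<integral>y. f (merge I {i} (v, y)) \<partial>(\<Pi>\<^sub>M l\<in>{i}. lborel)) = (\<integral>x. f (v(i := x)) \<partial>lborel)" .
  qed
  finally show ?thesis .
qed

text \<open>
  Up to the Gamma factor this is \<open>H\<close> with indices \<open>k + 1, 1, \<dots>, 1\<close>, the exponent \<open>s\<close> being
  decoupled from the number of nodes. The recursion trades a node for a unit of \<open>k\<close> at fixed \<open>s\<close>.
\<close>

definition simplex_power_integral :: "nat \<Rightarrow> nat set \<Rightarrow> real \<Rightarrow> (nat \<Rightarrow> real) \<Rightarrow> real" where
  "simplex_power_integral k I s z =
     simplex_integral I (\<lambda>u. (1 - (\<Sum>l\<in>I. u l)) ^ k / fact k) s z"

lemma bounded_weight_power:
  assumes "finite I"
  shows "bounded_weight I (\<lambda>u. (1 - (\<Sum>l\<in>I. u l)) ^ k / fact k)"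
proof -
  have "\<bar>(1 - (\<Sum>l\<in>I. u l)) ^ k / fact k\<bar> \<le> 1 / fact k" if u: "u \<in> unit_simplex I" for u
  proof -
    have "0 \<le> 1 - (\<Sum>l\<in>I. u l)" "1 - (\<Sum>l\<in>I. u l) \<le> 1"
      using unit_simplexD[OF u] by (auto intro: sum_nonneg)
    then show ?thesis
      by (simp add: abs_divide power_abs power_le_one divide_right_mono)
  qed
  moreover have "(\<lambda>u. (1 - (\<Sum>l\<in>I. u l)) ^ k / fact k :: real) \<in> borel_measurable (\<Pi>\<^sub>M l\<in>I. lborel)"
    by (intro borel_measurable_divide borel_measurable_power borel_measurable_diff
        borel_measurable_const borel_measurable_sum) simp
  ultimately show ?thesis unfolding bounded_weight_def by blast
qed

lemma unit_simplex_insert_iff: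
  assumes "finite J" "r \<notin> J" "v \<in> extensional J"
  shows "v(r := x) \<in> unit_simplex (insert r J) \<longleftrightarrow>
           (\<forall>l\<in>J. 0 \<le> v l) \<and> 0 \<le> x \<and> x + (\<Sum>l\<in>J. v l) \<le> 1"
proof -
  have "(\<Sum>l\<in>insert r J. (v(r := x)) l) = x + (\<Sum>l\<in>J. v l)"
    using assms(1,2) by (simp add: sum.insert) (intro sum.cong, auto)
  then show ?thesis
    using assms by (auto simp: unit_simplex_def PiE_iff extensional_def)
qed

lemma sum_fun_upd_insert:
  fixes v :: "nat \<Rightarrow> real"
  assumes "finite J" "r \<notin> J"
  shows "(\<Sum>l\<in>insert r J. (v(r := x)) l) = x + (\<Sum>l\<in>J. v l)"
  using assms by (simp add: sum.insert) (intro sum.cong, auto)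

lemma sum_insert_fun_upd:
  fixes a v :: "nat \<Rightarrow> real"
  assumes "finite J" "r \<notin> J"
  shows "(\<Sum>l\<in>insert r J. a l * (v(r := x)) l) = a r * x + (\<Sum>l\<in>J. a l * v l)"
  using assms by (simp add: sum.insert) (intro sum.cong, auto)

text \<open>
  The inequality says that the base is positive at the point of the larger simplex whose new
  coordinate takes up all the slack of \<open>v\<close>.
\<close>

lemma simplex_slice_pos:
  assumes "finite J" "r \<notin> J" "\<forall>l\<in>insert r J. z l < 1" "v \<in> unit_simplex J"
  shows "z r * (1 - (\<Sum>l\<in>J. v l)) < 1 - (\<Sum>l\<in>J. z l * v l)"
proof -
  have "v(r := 1 - (\<Sum>l\<in>J. v l)) \<in> unit_simplex (insert r J)"
    using assms by (subst unit_simplex_insert_iff) (auto simp: unit_simplex_def PiE_iff)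
  from kernel_base_pos[OF _ assms(3) this, unfolded sum_insert_fun_upd[OF assms(1,2)]] assms(1)
  show ?thesis by simp
qed

lemma one_slice_integral:
  assumes J: "finite J" "r \<notin> J" and v: "v \<in> unit_simplex J"
  shows "(\<integral>x. simplex_integrand (insert r J) (\<lambda>u. (1 - (\<Sum>l\<in>insert r J. u l)) ^ k / fact k) s z (v(r := x)) \<partial>lborel) =
     (\<integral>x. indicator {0..1 - (\<Sum>l\<in>J. v l)} x * ((1 - (\<Sum>l\<in>J. v l) - x) ^ k *
         (1 - (\<Sum>l\<in>J. z l * v l) - z r * x) powr (- s)) \<partial>lborel) / fact k"
proof -
  have ext: "v \<in> extensional J" using v by (auto simp: unit_simplex_def PiE_iff)
  have "simplex_integrand (insert r J) (\<lambda>u. (1 - (\<Sum>l\<in>insert r J. u l)) ^ k / fact k) s z (v(r := x)) =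
     (indicator {0..1 - (\<Sum>l\<in>J. v l)} x * ((1 - (\<Sum>l\<in>J. v l) - x) ^ k *
         (1 - (\<Sum>l\<in>J. z l * v l) - z r * x) powr (- s))) / fact k" for x
    unfolding simplex_integrand_def sum_insert_fun_upd[OF J]
      sum_fun_upd_insert[OF J] indicator_def unit_simplex_insert_iff[OF J ext]
    using unit_simplexD[OF v] by (auto simp: diff_diff_eq add.commute)
  then show ?thesis by simp
qed

lemma two_slice_integral:
  assumes J: "finite J" "p \<notin> J" "q \<notin> J" "p \<noteq> q" and v: "v \<in> unit_simplex J"
  shows "(\<integral>y. \<integral>x. simplex_integrand (insert p (insert q J))
             (\<lambda>u. (1 - (\<Sum>l\<in>insert p (insert q J). u l)) ^ k / fact k) s z (v(q := y, p := x)) \<partial>lborel \<partial>lborel) =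
     (\<integral>y. \<integral>x. indicator {(x, y). 0 \<le> x \<and> 0 \<le> y \<and> x + y \<le> 1 - (\<Sum>l\<in>J. v l)} (x, y) *
         ((1 - (\<Sum>l\<in>J. v l) - x - y) ^ k *
         (1 - (\<Sum>l\<in>J. z l * v l) - z p * x - z q * y) powr (- s)) \<partial>lborel \<partial>lborel) / fact k"
proof -
  have ext: "v \<in> extensional J" using v by (auto simp: unit_simplex_def PiE_iff)
  have ext': "v(q := y) \<in> extensional (insert q J)" for y
    using ext by (auto simp: extensional_def)
  have J': "finite (insert q J)" "p \<notin> insert q J" using J by auto
  have all: "(\<forall>l\<in>insert q J. 0 \<le> (v(q := y)) l) \<longleftrightarrow> 0 \<le> y" for y
    using unit_simplexD[OF v] J by auto
  have "simplex_integrand (insert p (insert q J))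
             (\<lambda>u. (1 - (\<Sum>l\<in>insert p (insert q J). u l)) ^ k / fact k) s z (v(q := y, p := x)) =
     (indicator {(x, y). 0 \<le> x \<and> 0 \<le> y \<and> x + y \<le> 1 - (\<Sum>l\<in>J. v l)} (x, y) *
         ((1 - (\<Sum>l\<in>J. v l) - x - y) ^ k *
         (1 - (\<Sum>l\<in>J. z l * v l) - z p * x - z q * y) powr (- s))) / fact k" for x y
    unfolding simplex_integrand_def sum_insert_fun_upd[OF J'] sum_insert_fun_upd[OF J(1,3)]
      sum_fun_upd_insert[OF J'] sum_fun_upd_insert[OF J(1,3)]
      indicator_def unit_simplex_insert_iff[OF J' ext'] all
    by (auto simp: diff_diff_eq add_ac)
  then show ?thesis by simp
qed

text \<open>
  Freeze the coordinates in \<open>J\<close>. The remaining two run through the triangle of size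
  \<open>R = 1 - (\<Sum>l\<in>J. v l)\<close>, and the single coordinates on the right through \<open>{0..R}\<close>, so the identity
  is the one for the triangle, integrated over \<open>v\<close>. The factor \<open>Suc k\<close> there is what turns
  \<open>fact k\<close> into \<open>fact (Suc k)\<close>.
\<close>

lemma simplex_power_integral_difference:
  assumes J: "finite J" "p \<notin> J" "q \<notin> J" "p \<noteq> q"
    and z: "\<forall>l\<in>insert p (insert q J). z l < 1"
  shows "(z p - z q) * simplex_power_integral k (insert p (insert q J)) s z =
         z p * simplex_power_integral (Suc k) (insert p J) s z -
         z q * simplex_power_integral (Suc k) (insert q J) s z"
proof -
  define f where "f = simplex_integrand (insert p (insert q J))
             (\<lambda>u. (1 - (\<Sum>l\<in>insert p (insert q J). u l)) ^ k / fact k) s z"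
  define f1 where "f1 r = simplex_integrand (insert r J)
             (\<lambda>u. (1 - (\<Sum>l\<in>insert r J. u l)) ^ Suc k / fact (Suc k)) s z" for r
  have intf: "integrable (\<Pi>\<^sub>M l\<in>insert p (insert q J). lborel) f"
    unfolding f_def using J z by (intro integrable_simplex_integrand bounded_weight_power) auto
  have intf1: "integrable (\<Pi>\<^sub>M l\<in>insert r J. lborel) (f1 r)" if "r \<in> {p, q}" for r
    unfolding f1_def using J z that by (intro integrable_simplex_integrand bounded_weight_power) auto
  have J': "finite (insert q J)" "p \<notin> insert q J" using J by auto
  have int2: "integrable (\<Pi>\<^sub>M l\<in>insert q J. lborel) (\<lambda>v. \<integral>x. f (v(p := x)) \<partial>lborel)"
    by (rule integrable_product_insert[OF J' intf])
  have int1: "integrable (\<Pi>\<^sub>M l\<in>J. lborel) (\<lambda>v. \<integral>x. f1 r (v(r := x)) \<partial>lborel)" if "r \<in> {p, q}" for r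
    using that J by (intro integrable_product_insert intf1) auto
  \<comment> \<open>Points \<open>v\<close> outside the simplex contribute zero on both sides.\<close>
  have slice: "(z p - z q) * (\<integral>y. \<integral>x. f (v(q := y, p := x)) \<partial>lborel \<partial>lborel) =
        z p * (\<integral>x. f1 p (v(p := x)) \<partial>lborel) - z q * (\<integral>x. f1 q (v(q := x)) \<partial>lborel)"
    if "v \<in> space (\<Pi>\<^sub>M l\<in>J. lborel :: real measure)" for v
  proof (cases "v \<in> unit_simplex J")
    case True
    define R where "R = 1 - (\<Sum>l\<in>J. v l)"
    define c where "c = 1 - (\<Sum>l\<in>J. z l * v l)"
    have R: "0 \<le> R" using unit_simplexD(2)[OF True] by (simp add: R_def)
    have c: "0 < c" using kernel_base_pos[OF J(1) _ True] z by (simp add: c_def)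
    have p: "z p * R < c" and q: "z q * R < c"
      unfolding R_def c_def using J z True by (auto intro!: simplex_slice_pos)
    have fact: "fact (Suc k) = real (Suc k) * fact k" by simp
    show ?thesis
      unfolding f_def f1_def two_slice_integral[OF J True] one_slice_integral[OF J(1,2) True]
        one_slice_integral[OF J(1,3) True] R_def[symmetric] c_def[symmetric]
      unfolding times_divide_eq_right triangle_integral_difference[OF R c p q] fact
      by (simp add: diff_divide_distrib del: power_Suc of_nat_Suc)
  next
    case False
    have ext: "v \<in> extensional J" using that by (auto simp: space_PiM PiE_iff)
    have out1: "v(r := x) \<notin> unit_simplex (insert r J)" if "r \<notin> J" for r x
      using False sum_nonneg[of J v] ext
      by (subst unit_simplex_insert_iff[OF J(1) that ext]) (auto simp: unit_simplex_def PiE_iff)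
    have ext': "v(q := y) \<in> extensional (insert q J)" for y
      using ext by (auto simp: extensional_def)
    have out2: "v(q := y, p := x) \<notin> unit_simplex (insert p (insert q J))" for x y
    proof
      assume "v(q := y, p := x) \<in> unit_simplex (insert p (insert q J))"
      then have "v(q := y) \<in> unit_simplex (insert q J)"
        unfolding unit_simplex_insert_iff[OF J' ext'] using ext'[of y]
        by (auto simp: unit_simplex_def PiE_iff)
      with out1[OF J(3)] show False by blast
    qed
    show ?thesis
      using out1[OF J(2)] out1[OF J(3)] out2 by (simp add: f_def f1_def simplex_integrand_def)
  qed
  have "simplex_power_integral k (insert p (insert q J)) s z =
      (\<integral>v. \<integral>x. f (v(p := x)) \<partial>lborel \<partial>(\<Pi>\<^sub>M l\<in>insert q J. lborel))"
    unfolding simplex_power_integral_def simplex_integral_eq f_def[symmetric]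
    by (rule lborel_product.product_integral_insert[OF J' intf])
  also have "\<dots> = (\<integral>v. \<integral>y. \<integral>x. f (v(q := y, p := x)) \<partial>lborel \<partial>lborel \<partial>(\<Pi>\<^sub>M l\<in>J. lborel))"
    by (rule lborel_product.product_integral_insert[OF J(1,3) int2])
  finally have "(z p - z q) * simplex_power_integral k (insert p (insert q J)) s z =
      (\<integral>v. (z p - z q) * (\<integral>y. \<integral>x. f (v(q := y, p := x)) \<partial>lborel \<partial>lborel) \<partial>(\<Pi>\<^sub>M l\<in>J. lborel))"
    by simp
  also have "\<dots> = (\<integral>v. z p * (\<integral>x. f1 p (v(p := x)) \<partial>lborel) - z q * (\<integral>x. f1 q (v(q := x)) \<partial>lborel)
                    \<partial>(\<Pi>\<^sub>M l\<in>J. lborel))"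
    by (rule Bochner_Integration.integral_cong[OF refl slice])
  also have "\<dots> = z p * (\<integral>v. \<integral>x. f1 p (v(p := x)) \<partial>lborel \<partial>(\<Pi>\<^sub>M l\<in>J. lborel)) -
                 z q * (\<integral>v. \<integral>x. f1 q (v(q := x)) \<partial>lborel \<partial>(\<Pi>\<^sub>M l\<in>J. lborel))"
    using int1 by (subst Bochner_Integration.integral_diff) auto
  also have "(\<integral>v. \<integral>x. f1 r (v(r := x)) \<partial>lborel \<partial>(\<Pi>\<^sub>M l\<in>J. lborel)) =
      simplex_power_integral (Suc k) (insert r J) s z" if "r \<in> {p, q}" for r
    unfolding simplex_power_integral_def simplex_integral_eq f1_def[symmetric]
    using that J intf1[OF that] by (intro lborel_product.product_integral_insert[symmetric]) auto
  then have "z p * (\<integral>v. \<integral>x. f1 p (v(p := x)) \<partial>lborel \<partial>(\<Pi>\<^sub>M l\<in>J. lborel)) -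
      z q * (\<integral>v. \<integral>x. f1 q (v(q := x)) \<partial>lborel \<partial>(\<Pi>\<^sub>M l\<in>J. lborel)) =
      z p * simplex_power_integral (Suc k) (insert p J) s z -
      z q * simplex_power_integral (Suc k) (insert q J) s z" by simp
  finally show ?thesis .
qed

lemma simplex_power_integral_singleton:
  "simplex_power_integral k {i} s z =
     (\<integral>x. indicator {0..1} x * ((1 - x) ^ k / fact k * (1 - z i * x) powr (- s)) \<partial>lborel)"
proof -
  have meas: "(\<lambda>x. indicator {0..1} x * ((1 - x) ^ k / fact k * (1 - z i * x) powr (- s))) \<in> borel_measurable lborel"
    by measurable
  have "simplex_power_integral k {i} s z =
      (\<integral>u. indicator {0..1} (u i) * ((1 - u i) ^ k / fact k * (1 - z i * u i) powr (- s)) \<partial>(\<Pi>\<^sub>M l\<in>{i}. lborel))"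
    unfolding simplex_power_integral_def simplex_integral_eq
    by (rule Bochner_Integration.integral_cong)
       (auto simp: simplex_integrand_def unit_simplex_def space_PiM PiE_iff indicator_def)
  also have "\<dots> = (\<integral>x. indicator {0..1} x * ((1 - x) ^ k / fact k * (1 - z i * x) powr (- s)) \<partial>lborel)"
    by (rule lborel_product.product_integral_singleton[OF meas])
  finally show ?thesis .
qed

section \<open>Divided differences\<close>

text \<open>
  By the Leibniz rule, the divided difference of \<open>t * h t\<close> is that of \<open>h\<close> times one of the end
  nodes, plus the divided difference of \<open>h\<close> with this end node left out. In the recursion for
  \<open>t * h t\<close> take the first node as the end node for the shorter difference on the left, and the
  last node for the one on the right: the remaining terms are then both the divided difference of
  \<open>h\<close> at the inner nodes, and cancel.
\<close>

lemma divdiff_rec_mult_node: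
  assumes "inj_on z {i..i + Suc k}"
  shows "divdiff_rec (\<lambda>t. t * h t) z i (Suc k) =
    (z i * divdiff_rec h z i k - z (i + Suc k) * divdiff_rec h z (Suc i) k) / (z i - z (i + Suc k))"
  using assms
proof (induction k arbitrary: i)
  case 0
  then show ?case by simp
next
  case (Suc k)
  have ne: "z i \<noteq> z (i + Suc (Suc k))" "z i \<noteq> z (i + Suc k)" "z (Suc i) \<noteq> z (i + Suc (Suc k))"
    using inj_onD[OF Suc.prems, of i "i + Suc (Suc k)"] inj_onD[OF Suc.prems, of i "i + Suc k"]
      inj_onD[OF Suc.prems, of "Suc i" "i + Suc (Suc k)"] by auto
  have IH1: "divdiff_rec (\<lambda>t. t * h t) z i (Suc k) =
     z i * divdiff_rec h z i (Suc k) + divdiff_rec h z (Suc i) k"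
    using Suc.IH[of i] inj_on_subset[OF Suc.prems, of "{i..i + Suc k}"] ne(2)
    by (simp add: field_simps)
  have IH2: "divdiff_rec (\<lambda>t. t * h t) z (Suc i) (Suc k) =
     z (i + Suc (Suc k)) * divdiff_rec h z (Suc i) (Suc k) + divdiff_rec h z (Suc i) k"
    using Suc.IH[of "Suc i"] inj_on_subset[OF Suc.prems, of "{Suc i..Suc i + Suc k}"] ne(3)
    by (simp add: field_simps)
  show ?case
    unfolding divdiff_rec.simps(2)[of "\<lambda>t. t * h t" z i "Suc k"] IH1 IH2 by simp
qed

lemma divdiff_rec_cmult:
  "divdiff_rec (\<lambda>t. c * f t) z i k = c * divdiff_rec f z i k"
  by (induction k arbitrary: i) (simp_all add: algebra_simps)

text \<open>
  Both sides satisfy the same recursion in the number of nodes: the left one because multiplication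
  by \<open>t\<close> acts on divided differences by the preceding rule, the right one by
  \<open>simplex_power_integral_difference\<close> for the two end nodes.
\<close>

lemma divdiff_simplex_power_integral:
  assumes "inj_on z {i..i + r}" "\<forall>l\<in>{i..i + r}. z l < 1"
  shows "divdiff_rec (\<lambda>t. t ^ r * simplex_power_integral (k + r) {1} s (\<lambda>_. t)) z i r =
           simplex_power_integral k {i..i + r} s z"
  using assms
proof (induction r arbitrary: i k)
  case 0
  then show ?case by (simp add: simplex_power_integral_singleton)
next
  case (Suc r)
  define h where "h = (\<lambda>t. t ^ r * simplex_power_integral (Suc k + r) {1} s (\<lambda>_. t))"
  have ne: "z i \<noteq> z (i + Suc r)"
    using inj_onD[OF Suc.prems(1), of i "i + Suc r"] by auto
  have "divdiff_rec (\<lambda>t. t ^ Suc r * simplex_power_integral (k + Suc r) {1} s (\<lambda>_. t)) z i (Suc r) =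
      divdiff_rec (\<lambda>t. t * h t) z i (Suc r)"
    by (simp add: h_def mult.assoc)
  also have "\<dots> = (z i * divdiff_rec h z i r - z (i + Suc r) * divdiff_rec h z (Suc i) r) / (z i - z (i + Suc r))"
    by (rule divdiff_rec_mult_node[OF Suc.prems(1)])
  also have "divdiff_rec h z i r = simplex_power_integral (Suc k) {i..i + r} s z"
    unfolding h_def using Suc.prems by (intro Suc.IH) (auto intro: inj_on_subset)
  also have "divdiff_rec h z (Suc i) r = simplex_power_integral (Suc k) {Suc i..Suc i + r} s z"
    unfolding h_def using Suc.prems by (intro Suc.IH) (auto intro: inj_on_subset)
  also have "{i..i + r} = insert i {Suc i..i + r}" by auto
  also have "{Suc i..Suc i + r} = insert (i + Suc r) {Suc i..i + r}" by auto
  also have "z i * simplex_power_integral (Suc k) (insert i {Suc i..i + r}) s z -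
      z (i + Suc r) * simplex_power_integral (Suc k) (insert (i + Suc r) {Suc i..i + r}) s z =
      (z i - z (i + Suc r)) * simplex_power_integral k (insert i (insert (i + Suc r) {Suc i..i + r})) s z"
    by (rule simplex_power_integral_difference[symmetric]) (use Suc.prems(2) in auto)
  also have "insert i (insert (i + Suc r) {Suc i..i + r}) = {i..i + Suc r}" by auto
  finally show ?case using ne by simp
qed

text \<open>
  Along the line \<open>\<epsilon> \<mapsto> (\<lambda>l. z l + \<epsilon> * l)\<close> two given coordinates coincide for at most
  one \<open>\<epsilon>\<close>, so \<open>z\<close> is a limit of tuples with distinct nodes and the limit in the definition
  of \<open>divided_difference\<close> is unique.
\<close>

lemma at_within_inj_on_nontrivial:
  fixes z :: "nat \<Rightarrow> real"
  assumes "finite I" "\<not> inj_on z I"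
  shows "at z within {w. inj_on w I} \<noteq> bot"
proof -
  define w where "w = (\<lambda>(\<epsilon>::real) l. z l + \<epsilon> * real l)"
  define B where "B = (\<lambda>(l, l'). (z l - z l') / (real l' - real l)) ` (I \<times> I)"
  have "finite B" using assms(1) by (simp add: B_def)
  have inj: "inj_on (w \<epsilon>) I" if "\<epsilon> \<notin> B" for \<epsilon>
  proof (rule inj_onI, rule ccontr)
    fix l l' assume "l \<in> I" "l' \<in> I" "w \<epsilon> l = w \<epsilon> l'" "l \<noteq> l'"
    then have "\<epsilon> = (z l - z l') / (real l' - real l)"
      by (simp add: w_def field_simps)
    with \<open>l \<in> I\<close> \<open>l' \<in> I\<close> that show False by (auto simp: B_def)
  qed
  have "continuous_on UNIV w"
    unfolding w_def by (intro continuous_on_coordinatewise_then_product continuous_intros)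
  then have "w \<midarrow>0\<rightarrow> w 0" by (auto simp: continuous_on_def)
  moreover have "w 0 = z" by (simp add: w_def)
  ultimately have lim: "w \<midarrow>0\<rightarrow> z" by simp
  have "\<forall>\<^sub>F \<epsilon> in at 0. \<epsilon> \<notin> B"
    using \<open>finite B\<close> by (auto simp: eventually_at_topological intro!: exI[of _ "- (B - {0})"]
        open_Compl finite_imp_closed)
  then have "\<forall>\<^sub>F \<epsilon> in at 0. w \<epsilon> \<in> {w. inj_on w I} \<and> w \<epsilon> \<noteq> z"
    by eventually_elim (use inj assms(2) in auto)
  with lim have "filterlim w (at z within {w. inj_on w I}) (at 0)"
    by (simp add: filterlim_at)
  then show ?thesis
    by (auto simp: filterlim_def bot_unique filtermap_bot_iff)
qed

section \<open>The functions H\<close>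

lemma H_eq_simplex_integral:
  "H n \<alpha> z m j = Gamma (d n \<alpha> m j + 1) * simplex_integral {1..n} (\<omega> n \<alpha>) (d n \<alpha> m j + 1) z"
  by (simp add: H_def simplex_integral_def simplex_std_def unit_simplex_def)

lemma H_cong:
  assumes "\<And>l. l \<le> n \<Longrightarrow> \<alpha> l = \<beta> l"
  shows "H n \<alpha> z m j = H n \<beta> z m j"
proof -
  have "d n \<alpha> m j = d n \<beta> m j"
    using assms by (simp add: d_def)
  moreover have "\<omega> n \<alpha> = \<omega> n \<beta>"
    using assms by (simp add: \<omega>_def fun_eq_iff)
  ultimately show ?thesis by (simp add: H_def)
qed

lemma bounded_weight_\<omega>: "bounded_weight {1..n} (\<omega> n \<alpha>)"
proof -
  define C where "C = 1 / (\<Prod>l=0..n. Gamma (real (\<alpha> l)))"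
  have "\<bar>\<omega> n \<alpha> u\<bar> \<le> \<bar>C\<bar>" if u: "u \<in> unit_simplex {1..n}" for u
  proof -
    have "0 \<le> 1 - (\<Sum>l=1..n. u l)" "1 - (\<Sum>l=1..n. u l) \<le> 1"
      using unit_simplexD[OF u] by (auto intro: sum_nonneg)
    then have "\<bar>(1 - (\<Sum>l=1..n. u l)) ^ (\<alpha> 0 - 1)\<bar> \<le> 1"
      by (simp add: power_abs power_le_one)
    moreover have "\<bar>\<Prod>l=1..n. u l ^ (\<alpha> l - 1)\<bar> \<le> 1"
      unfolding abs_prod using unit_simplexD(1)[OF u] unit_simplex_le_1[OF u]
      by (intro prod_le_1) (auto simp: power_abs intro!: power_le_one)
    ultimately have "\<bar>(1 - (\<Sum>l=1..n. u l)) ^ (\<alpha> 0 - 1)\<bar> * \<bar>\<Prod>l=1..n. u l ^ (\<alpha> l - 1)\<bar> \<le> 1"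
      by (intro mult_le_one) auto
    then have "\<bar>C\<bar> * (\<bar>(1 - (\<Sum>l=1..n. u l)) ^ (\<alpha> 0 - 1)\<bar> * \<bar>\<Prod>l=1..n. u l ^ (\<alpha> l - 1)\<bar>) \<le> \<bar>C\<bar> * 1"
      by (intro mult_left_mono) auto
    then show ?thesis unfolding \<omega>_def C_def by (simp add: abs_mult mult.assoc)
  qed
  moreover have "\<omega> n \<alpha> \<in> borel_measurable (\<Pi>\<^sub>M l\<in>{1..n}. lborel)"
    unfolding \<omega>_def
    by (intro borel_measurable_times borel_measurable_const borel_measurable_power borel_measurable_diff
        borel_measurable_sum borel_measurable_prod) simp_all
  ultimately show ?thesis unfolding bounded_weight_def by blast
qed

text \<open>
  From \<open>Gamma (x + 1) = x * Gamma x\<close>: a further factor \<open>u l\<close> amounts to raising the index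
  \<open>\<alpha> l\<close>, except for the normalisation.
\<close>

lemma \<omega>_mult_coordinate:
  assumes "l \<in> {1..n}" "\<alpha> l > 0"
  shows "\<omega> n \<alpha> u * u l = real (\<alpha> l) * \<omega> n (\<alpha>(l := Suc (\<alpha> l))) u"
proof -
  let ?\<beta> = "\<alpha>(l := Suc (\<alpha> l))"
  have "(\<Prod>i=0..n. Gamma (real (?\<beta> i))) = Gamma (real (?\<beta> l)) * (\<Prod>i\<in>{0..n} - {l}. Gamma (real (?\<beta> i)))"
    using assms by (intro prod.remove) auto
  also have "(\<Prod>i\<in>{0..n} - {l}. Gamma (real (?\<beta> i))) = (\<Prod>i\<in>{0..n} - {l}. Gamma (real (\<alpha> i)))"
    by (intro prod.cong) auto
  also have "Gamma (real (?\<beta> l)) = real (\<alpha> l) * Gamma (real (\<alpha> l))"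
    using Gamma_plus1[of "real (\<alpha> l)"] assms(2) by (force simp: add.commute dest: nonpos_Ints_nonpos)
  also have "real (\<alpha> l) * Gamma (real (\<alpha> l)) * (\<Prod>i\<in>{0..n} - {l}. Gamma (real (\<alpha> i))) =
      real (\<alpha> l) * (\<Prod>i=0..n. Gamma (real (\<alpha> i)))"
    using assms by (subst prod.remove[of "{0..n}" l]) (auto simp: mult.assoc)
  finally have G: "(\<Prod>i=0..n. Gamma (real (?\<beta> i))) = real (\<alpha> l) * (\<Prod>i=0..n. Gamma (real (\<alpha> i)))" .
  have "(\<Prod>i=1..n. u i ^ (?\<beta> i - 1)) = u l ^ \<alpha> l * (\<Prod>i\<in>{1..n} - {l}. u i ^ (?\<beta> i - 1))"
    using assms by (subst prod.remove[of "{1..n}" l]) auto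
  also have "(\<Prod>i\<in>{1..n} - {l}. u i ^ (?\<beta> i - 1)) = (\<Prod>i\<in>{1..n} - {l}. u i ^ (\<alpha> i - 1))"
    by (intro prod.cong) auto
  also have "u l ^ \<alpha> l = u l * u l ^ (\<alpha> l - 1)"
    using assms(2) by (cases "\<alpha> l") auto
  also have "u l * u l ^ (\<alpha> l - 1) * (\<Prod>i\<in>{1..n} - {l}. u i ^ (\<alpha> i - 1)) = u l * (\<Prod>i=1..n. u i ^ (\<alpha> i - 1))"
    using assms by (subst prod.remove[of "{1..n}" l]) (auto simp: mult.assoc)
  finally have P: "(\<Prod>i=1..n. u i ^ (?\<beta> i - 1)) = u l * (\<Prod>i=1..n. u i ^ (\<alpha> i - 1))" .
  have "?\<beta> 0 = \<alpha> 0" using assms by auto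
  then show ?thesis
    unfolding \<omega>_def G P using assms(2) by (simp add: field_simps)
qed

text \<open>
  The factor \<open>s\<close> produced by the derivative of the kernel is absorbed by the Gamma factor,
  \<open>s * Gamma s = Gamma (s + 1)\<close>, and the exponent \<open>s\<close> moves up together with the sum of the
  indices.
\<close>

lemma DERIV_H:
  assumes "l \<in> {1..n}" "\<alpha> l > 0" "\<forall>i\<in>{1..n}. z i < 1" "d n \<alpha> m j + 1 \<notin> \<int>\<^sub>\<le>\<^sub>0"
  shows "((\<lambda>t. H n \<alpha> (z(l := t)) m j) has_real_derivative
           real (\<alpha> l) * H n (\<alpha>(l := Suc (\<alpha> l))) z m j) (at (z l))"
proof -
  define s where "s = d n \<alpha> m j + 1"
  let ?\<beta> = "\<alpha>(l := Suc (\<alpha> l))"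
  have "(\<Sum>i=0..n. ?\<beta> i) = Suc (\<Sum>i=0..n. \<alpha> i)"
    using assms(1) by (subst (1 2) sum.remove[of _ l]) auto
  then have s': "d n ?\<beta> m j + 1 = s + 1" by (simp add: d_def s_def)
  have "simplex_integral {1..n} (\<lambda>u. \<omega> n \<alpha> u * u l) (s + 1) z =
      simplex_integral {1..n} (\<lambda>u. real (\<alpha> l) * \<omega> n ?\<beta> u) (s + 1) z"
    unfolding \<omega>_mult_coordinate[where n = n and \<alpha> = \<alpha> and l = l, OF assms(1,2)] ..
  also have "\<dots> = real (\<alpha> l) * simplex_integral {1..n} (\<omega> n ?\<beta>) (s + 1) z"
    unfolding simplex_integral_def by (simp add: mult.assoc)
  finally have *: "simplex_integral {1..n} (\<lambda>u. \<omega> n \<alpha> u * u l) (s + 1) z =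
      real (\<alpha> l) * simplex_integral {1..n} (\<omega> n ?\<beta>) (s + 1) z" .
  have "Gamma (s + 1) = s * Gamma s" using assms(4) unfolding s_def by (rule Gamma_plus1)
  with DERIV_cmult[OF DERIV_simplex_integral[OF _ bounded_weight_\<omega> assms(3,1), of \<alpha> s], of "Gamma s"]
  show ?thesis
    unfolding H_eq_simplex_integral s' s_def[symmetric] * by (simp add: mult_ac)
qed

text \<open>
  The functions are controlled only to the left of \<open>b\<close>. This suffices as \<open>deriv\<close> is local and
  the half-line is open.
\<close>

lemma higher_deriv_lessThan:
  fixes f :: "real \<Rightarrow> real" and g :: "nat \<Rightarrow> real \<Rightarrow> real"
  assumes "\<And>t. t < b \<Longrightarrow> f t = g 0 t"
    and "\<And>i t. t < b \<Longrightarrow> (g i has_real_derivative g (Suc i) t) (at t)"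
    and "t < b"
  shows "(deriv ^^ k) f t = g k t"
  using assms(3)
proof (induction k arbitrary: t)
  case 0
  then show ?case using assms(1) by simp
next
  case (Suc k)
  have "\<forall>\<^sub>F x in nhds t. (deriv ^^ k) f x = g k x"
    using Suc by (auto simp: eventually_nhds intro!: exI[of _ "{..<b}"])
  then have "deriv ((deriv ^^ k) f) t = deriv (g k) t"
    by (rule deriv_cong_ev) simp
  also have "\<dots> = g (Suc k) t"
    by (rule DERIV_imp_deriv[OF assms(2)[OF Suc.prems]])
  finally show ?case by simp
qed

lemma partial_deriv_H:
  assumes l: "l \<in> {1..n}" "\<gamma> l = 1" and z: "\<forall>i\<in>{1..n}. z i < 1"
    and pos: "\<And>k. d n (\<gamma>(l := Suc k)) m j + 1 \<notin> \<int>\<^sub>\<le>\<^sub>0"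
    and F: "\<And>x. \<forall>i\<in>{1..n}. x i < 1 \<Longrightarrow> F x = C * H n \<gamma> x m j"
  shows "partial_deriv l k F z = C * fact k * H n (\<gamma>(l := Suc k)) z m j"
proof -
  define g where "g = (\<lambda>k t. C * fact k * H n (\<gamma>(l := Suc k)) (z(l := t)) m j)"
  have "(deriv ^^ k) (\<lambda>t. F (z(l := t))) (z l) = g k (z l)"
  proof (rule higher_deriv_lessThan[where b = 1])
    show "F (z(l := t)) = g 0 t" if "t < 1" for t
      using F[of "z(l := t)"] that z l by (simp add: g_def fun_upd_idem)
    show "(g i has_real_derivative g (Suc i) t) (at t)" if "t < 1" for i t
    proof -
      have "((\<lambda>t'. H n (\<gamma>(l := Suc i)) ((z(l := t))(l := t')) m j) has_real_derivative
           real ((\<gamma>(l := Suc i)) l) * H n ((\<gamma>(l := Suc i))(l := Suc ((\<gamma>(l := Suc i)) l))) (z(l := t)) m j)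
             (at ((z(l := t)) l))"
        using l z that pos by (intro DERIV_H) auto
      then have "((\<lambda>t'. H n (\<gamma>(l := Suc i)) (z(l := t')) m j) has_real_derivative
           real (Suc i) * H n (\<gamma>(l := Suc (Suc i))) (z(l := t)) m j) (at t)"
        by simp
      from DERIV_cmult[OF this, of "C * fact i"] show ?thesis
        by (simp add: g_def mult_ac)
    qed
    show "z l < 1" using z l by auto
  qed
  then show ?thesis by (simp add: partial_deriv_def g_def)
qed

text \<open>
  The argument of \<open>Gamma\<close> is smallest when all indices other than \<open>\<gamma> 0\<close> are \<open>1\<close>; any other choice
  adds a natural number, which cannot turn a non-pole into a pole.
\<close>

lemma Gamma_argument_not_nonpos_Int:
  assumes "real a + real n + (real m - real j) / 2 - 1 \<notin> \<int>\<^sub>\<le>\<^sub>0"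
    and "\<gamma> 0 = a" "\<forall>l\<in>{1..n}. \<gamma> l > 0"
  shows "d n \<gamma> m j + 1 \<notin> \<int>\<^sub>\<le>\<^sub>0"
proof
  assume "d n \<gamma> m j + 1 \<in> \<int>\<^sub>\<le>\<^sub>0"
  then obtain k where k: "d n \<gamma> m j + 1 = - real k" by (elim nonpos_Ints_cases')
  have "n = (\<Sum>l=1..n. 1)" by simp
  also have "\<dots> \<le> (\<Sum>l=1..n. \<gamma> l)"
    using assms(3) by (intro sum_mono) (simp add: Suc_leI)
  finally obtain r where r: "(\<Sum>l=1..n. \<gamma> l) = n + r" using le_Suc_ex by blast
  have "(\<Sum>l=0..n. \<gamma> l) = a + n + r"
    using assms(2) r by (simp add: sum.atLeast_Suc_atMost)
  with k have "real a + real n + (real m - real j) / 2 - 1 = - real (k + r)"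
    by (simp add: d_def field_simps)
  with assms(1) show False by (metis minus_of_nat_in_nonpos_Ints)
qed

text \<open>
  Each variable is differentiated while its index is still \<open>1\<close>. The derivative of order
  \<open>\<alpha> l - 1\<close> then raises this index to \<open>\<alpha> l\<close>, at the cost of the factor
  \<open>1 * 2 * \<dots> * (\<alpha> l - 1)\<close>.
\<close>

lemma iterated_partial_deriv_H:
  fixes \<alpha> :: "nat \<Rightarrow> nat"
  assumes nonpole: "real (\<alpha> 0) + real n + (real m - real j) / 2 - 1 \<notin> \<int>\<^sub>\<le>\<^sub>0"
    and \<alpha>: "\<forall>l\<in>{0..n}. \<alpha> l > 0"
    and "distinct ls" "set ls \<subseteq> {1..n}" "\<forall>l\<in>{1..n}. z l < 1"
  shows "foldr (\<lambda>l. partial_deriv l (\<alpha> l - 1)) ls (\<lambda>x. H n ((\<lambda>_. 1)(0 := \<alpha> 0)) x m j) z =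
           (\<Prod>l\<in>set ls. fact (\<alpha> l - 1)) *
           H n (\<lambda>l. if l \<in> set ls then \<alpha> l else ((\<lambda>_. 1)(0 := \<alpha> 0)) l) z m j"
  using assms(3-5)
proof (induction ls arbitrary: z)
  case Nil
  then show ?case by simp
next
  case (Cons l ls)
  define \<gamma> where "\<gamma> = (\<lambda>l. if l \<in> set ls then \<alpha> l else ((\<lambda>_. 1)(0 := \<alpha> 0)) l)"
  have l: "l \<in> {1..n}" "l \<notin> set ls" and ls: "distinct ls" "set ls \<subseteq> {1..n}" using Cons.prems by auto
  have "foldr (\<lambda>l. partial_deriv l (\<alpha> l - 1)) (l # ls) (\<lambda>x. H n ((\<lambda>_. 1)(0 := \<alpha> 0)) x m j) z =
      partial_deriv l (\<alpha> l - 1)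
        (foldr (\<lambda>l. partial_deriv l (\<alpha> l - 1)) ls (\<lambda>x. H n ((\<lambda>_. 1)(0 := \<alpha> 0)) x m j)) z"
    by simp
  also have "\<dots> = (\<Prod>l\<in>set ls. fact (\<alpha> l - 1)) * fact (\<alpha> l - 1) * H n (\<gamma>(l := Suc (\<alpha> l - 1))) z m j"
  proof (rule partial_deriv_H)
    show "\<gamma> l = 1" using l by (simp add: \<gamma>_def)
    show "d n (\<gamma>(l := Suc k)) m j + 1 \<notin> \<int>\<^sub>\<le>\<^sub>0" for k
      by (rule Gamma_argument_not_nonpos_Int[where a = "\<alpha> 0"])
         (use nonpole l ls \<alpha> in \<open>auto simp: \<gamma>_def\<close>)
    show "foldr (\<lambda>l. partial_deriv l (\<alpha> l - 1)) ls (\<lambda>x. H n ((\<lambda>_. 1)(0 := \<alpha> 0)) x m j) x =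
        (\<Prod>l\<in>set ls. fact (\<alpha> l - 1)) * H n \<gamma> x m j" if "\<forall>i\<in>{1..n}. x i < 1" for x
      unfolding \<gamma>_def by (rule Cons.IH[OF ls that])
  qed (use l Cons.prems in auto)
  also have "\<gamma>(l := Suc (\<alpha> l - 1)) =
      (\<lambda>i. if i \<in> set (l # ls) then \<alpha> i else ((\<lambda>_. 1)(0 := \<alpha> 0)) i)"
    using \<alpha> l by (auto simp: \<gamma>_def fun_eq_iff)
  finally show ?case using l by (simp add: mult_ac)
qed

lemma H_unit_indices:
  assumes "a > 0"
  shows "H n ((\<lambda>_. 1)(0 := a)) z m j =
    Gamma (real a + real n + (real m - real j) / 2 - 1) *
    simplex_power_integral (a - 1) {1..n} (real a + real n + (real m - real j) / 2 - 1) z"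
proof -
  let ?\<gamma> = "((\<lambda>_. 1)(0 := a)) :: nat \<Rightarrow> nat"
  have d: "d n ?\<gamma> m j + 1 = real a + real n + (real m - real j) / 2 - 1"
    by (simp add: d_def sum.atLeast_Suc_atMost)
  have "(\<Prod>l=0..n. Gamma (real (?\<gamma> l))) = Gamma (real a)"
    by (simp add: prod.atLeast_Suc_atMost)
  also have "\<dots> = fact (a - 1)"
    using Gamma_fact[of "a - 1", where 'a = real] assms by (simp add: of_nat_diff)
  finally have "\<omega> n ?\<gamma> = (\<lambda>u. (1 - (\<Sum>l=1..n. u l)) ^ (a - 1) / fact (a - 1))"
    by (simp add: \<omega>_def fun_eq_iff)
  then show ?thesis
    unfolding H_eq_simplex_integral d simplex_power_integral_def by simp
qed

section \<open>Derivatives and divided differences of H\<close>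

theorem theorem3p9:
  fixes m j n :: nat
  assumes "m \<ge> 1" and "n \<ge> 1"
  shows
    "(\<forall>(\<alpha> :: nat \<Rightarrow> nat) (z :: nat \<Rightarrow> real).
        (\<forall>l\<in>{0..n}. \<alpha> l > 0) \<longrightarrow>
        real (\<alpha> 0) + real n + (real m - real j) / 2 - 1 \<notin> \<int>\<^sub>\<le>\<^sub>0 \<longrightarrow>
        (\<forall>l\<in>{1..n}. z l < 1) \<longrightarrow>
        H n \<alpha> z m j =
          mixed_partial n (\<lambda>l. \<alpha> l - 1) (\<lambda>x. H n ((\<lambda>_. 1)(0 := \<alpha> 0)) x m j) z
            / (\<Prod>l=1..n. fact (\<alpha> l - 1)))
     \<and>
     (\<forall>(a :: nat) (z :: nat \<Rightarrow> real).
        a > 0 \<longrightarrow>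
        real a + real n + (real m - real j) / 2 - 1 \<notin> \<int>\<^sub>\<le>\<^sub>0 \<longrightarrow>
        (\<forall>l\<in>{1..n}. z l < 1) \<longrightarrow>
        H n ((\<lambda>_. 1)(0 := a)) z m j =
          divided_difference
            (\<lambda>t. t ^ (n - 1) * H 1 ((\<lambda>_. 1)(0 := a + n - 1)) (\<lambda>_. t) m j) n z)"
proof (intro conjI allI impI)
  fix \<alpha> :: "nat \<Rightarrow> nat" and z :: "nat \<Rightarrow> real"
  assume \<alpha>: "\<forall>l\<in>{0..n}. \<alpha> l > 0"
    and nonpole: "real (\<alpha> 0) + real n + (real m - real j) / 2 - 1 \<notin> \<int>\<^sub>\<le>\<^sub>0"
    and z: "\<forall>l\<in>{1..n}. z l < 1"
  have set: "set [1..<Suc n] = {1..n}" by auto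
  have "mixed_partial n (\<lambda>l. \<alpha> l - 1) (\<lambda>x. H n ((\<lambda>_. 1)(0 := \<alpha> 0)) x m j) z =
      (\<Prod>l=1..n. fact (\<alpha> l - 1)) *
      H n (\<lambda>l. if l \<in> {1..n} then \<alpha> l else ((\<lambda>_. 1)(0 := \<alpha> 0)) l) z m j"
    unfolding mixed_partial_def
    by (rule iterated_partial_deriv_H[where \<alpha> = \<alpha> and ls = "[1..<Suc n]", unfolded set,
          OF nonpole \<alpha> distinct_upt subset_refl z])
  also have "H n (\<lambda>l. if l \<in> {1..n} then \<alpha> l else ((\<lambda>_. 1)(0 := \<alpha> 0)) l) z m j = H n \<alpha> z m j"
    by (rule H_cong) (auto simp: Suc_le_eq)
  finally have eq: "mixed_partial n (\<lambda>l. \<alpha> l - 1) (\<lambda>x. H n ((\<lambda>_. 1)(0 := \<alpha> 0)) x m j) z =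
      (\<Prod>l=1..n. fact (\<alpha> l - 1)) * H n \<alpha> z m j" .
  show "H n \<alpha> z m j =
          mixed_partial n (\<lambda>l. \<alpha> l - 1) (\<lambda>x. H n ((\<lambda>_. 1)(0 := \<alpha> 0)) x m j) z
            / (\<Prod>l=1..n. fact (\<alpha> l - 1))"
    unfolding eq by simp
next
  fix a :: nat and z :: "nat \<Rightarrow> real"
  assume a: "a > 0" and z: "\<forall>l\<in>{1..n}. z l < 1"
  define s where "s = real a + real n + (real m - real j) / 2 - 1"
  let ?f = "\<lambda>t. t ^ (n - 1) * H 1 ((\<lambda>_. 1)(0 := a + n - 1)) (\<lambda>_. t) m j"
  have s1: "real (a + n - 1) + real 1 + (real m - real j) / 2 - 1 = s"
    using a by (simp add: s_def of_nat_diff)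
  have "H 1 ((\<lambda>_. 1)(0 := a + n - 1)) (\<lambda>_. t) m j =
      Gamma s * simplex_power_integral (a - 1 + (n - 1)) {1} s (\<lambda>_. t)" for t
    using H_unit_indices[of "a + n - 1" 1 "\<lambda>_. t" m j] a assms(2) unfolding s1
    by (simp add: add.commute)
  then have f: "?f = (\<lambda>t. Gamma s * (t ^ (n - 1) * simplex_power_integral (a - 1 + (n - 1)) {1} s (\<lambda>_. t)))"
    by (simp add: mult_ac)
  have n: "{1..1 + (n - 1)} = {1..n}" using assms(2) by simp
  have Hz: "H n ((\<lambda>_. 1)(0 := a)) z m j = Gamma s * simplex_power_integral (a - 1) {1..n} s z"
    using H_unit_indices[OF a] by (simp add: s_def)
  have distinct: "divdiff_rec ?f w 1 (n - 1) = Gamma s * simplex_power_integral (a - 1) {1..n} s w"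
    if "inj_on w {1..n}" "\<forall>l\<in>{1..n}. w l < 1" for w
    unfolding f divdiff_rec_cmult
    using divdiff_simplex_power_integral[of w 1 "n - 1" "a - 1" s] that unfolding n by simp
  \<comment> \<open>For coinciding nodes, both sides are continuous extensions from distinct nodes.\<close>
  show "H n ((\<lambda>_. 1)(0 := a)) z m j = divided_difference ?f n z"
  proof (cases "inj_on z {1..n}")
    case True
    then show ?thesis unfolding Hz divided_difference_def using distinct[OF True z] by simp
  next
    case False
    let ?S = "{w. inj_on w {1..n}}"
    have cont: "((\<lambda>w. Gamma s * simplex_power_integral (a - 1) {1..n} s w) \<longlongrightarrow>
        Gamma s * simplex_power_integral (a - 1) {1..n} s z) (at z within ?S)"
      unfolding simplex_power_integral_def
      by (intro tendsto_mult_left tendsto_simplex_integral bounded_weight_power z) auto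
    have "open (\<Inter>l\<in>{1..n}. {w :: nat \<Rightarrow> real. w l < 1})"
      by (intro open_INT ballI open_Collect_less continuous_on_product_coordinates
          continuous_on_const finite_atLeastAtMost)
    also have "(\<Inter>l\<in>{1..n}. {w :: nat \<Rightarrow> real. w l < 1}) = {w. \<forall>l\<in>{1..n}. w l < 1}" by auto
    finally have "open {w :: nat \<Rightarrow> real. \<forall>l\<in>{1..n}. w l < 1}" .
    then have "\<forall>\<^sub>F w in at z within ?S. \<forall>l\<in>{1..n}. w l < 1"
      using z by (auto intro: eventually_at_topological[THEN iffD2])
    then have "\<forall>\<^sub>F w in at z within ?S. Gamma s * simplex_power_integral (a - 1) {1..n} s w =
        divdiff_rec ?f w 1 (n - 1)"
      using distinct by (auto simp: eventually_at_filter elim!: eventually_mono)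
    with cont have "((\<lambda>w. divdiff_rec ?f w 1 (n - 1)) \<longlongrightarrow>
        Gamma s * simplex_power_integral (a - 1) {1..n} s z) (at z within ?S)"
      by (rule Lim_transform_eventually)
    then have "Lim (at z within ?S) (\<lambda>w. divdiff_rec ?f w 1 (n - 1)) =
        Gamma s * simplex_power_integral (a - 1) {1..n} s z"
      by (rule tendsto_Lim[OF at_within_inj_on_nontrivial[OF finite_atLeastAtMost False]])
    then show ?thesis unfolding Hz divided_difference_def using False by simp
  qed
qed

end
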